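(* Let $X$ and $Y$ be finite-dimensional vector spaces over a non-trivial valuation field $(K,\nu)$ whose completion $\hat K$ is locally compact. Let $L:X\to Y$ be a $K$-linear map and let $T_X\in\tau_K(X)$ and $T_Y\in\tau_K(Y)$ be compatible topologies. Let $\hat L:\hat X\to\hat Y$ be the $\hat K$-linear map with $\hat L(\alpha\otimes x)=\alpha\otimes L(x)$ for all $\alpha\in\hat K$, $x\in X$. Then $L:(X,T_X)\to(Y,T_Y)$ is continuous if and only if $\hat L(\hat F(T_X))\subset\hat F(T_Y)$.
   Context: A topology on a set is a family of subsets satisfying the open set axioms. A valuation on a (commutative) field $K$ is a function $\nu:K\to\mathbb{R}$ with $\nu(\alpha)\ge 0$; $\nu(\alpha)=0\Leftrightarrow\alpha=0$; $\nu(\alpha\beta)=\nu(\alpha)\nu(\beta)$; $\nu(\alpha+\beta)\le\nu(\alpha)+\nu(\beta)$ for all $\alpha,\beta\in K$. The valuation field $(K,\nu)$ carries the topology of the metric $d_\nu(\alpha,\beta)=\nu(\alpha-\beta)$; it is non-trivial if this topology is not discrete. $\hat K$ denotes the metric completion of $(K,d_\nu)$, a valuation field with the extended operations and the extended valuation $\hat\nu$. For a vector space $Z$ over a Hausdorff topological field $k$, a (possibly non-Hausdorff) topology on $Z$ is compatible if addition $Z\times Z\to Z$ and scalar multiplication $k\times Z\to Z$ are continuous (product topologies on the domains). $\tau_k(Z)$ is the set of all compatible topologies on $Z$, and $T_k^{\max}(Z)$ is the largest element of $\tau_k(Z)$ with respect to inclusion (it exists). $\mathrm{cl}_T[A]$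 is the closure of $A$ with respect to $T$. For a finite-dimensional $K$-vector space $Z$ put $\hat Z=\hat K\otimes_K Z$ and let $I_Z:Z\to\hat Z$, $I_Z(z)=1\otimes z$. For $T\in\tau_K(Z)$ define $$\hat F(T)=\bigcap_{0\in U\in T}\mathrm{cl}_{T_{\hat K}^{\max}(\hat Z)}[I_Z(U)],$$ which is a $\hat K$-subspace of $\hat Z$. (This is applied with $Z=X$ and with $Z=Y$.) *)

theory Defs
  imports "HOL-Analysis.Analysis" "HOL-Library.Poly_Mapping"
begin

section \<open>Valuation fields and their completions\<close>

locale valuation_field =
  fixes \<nu> :: "'k::field \<Rightarrow> real"
  assumes nonneg: "\<nu> a \<ge> 0"
    and eq_zero_iff: "\<nu> a = 0 \<longleftrightarrow> a = 0"
    and mult: "\<nu> (a * b) = \<nu> a * \<nu> b"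
    and triangle: "\<nu> (a + b) \<le> \<nu> a + \<nu> b"

definition val_dist :: "('k::field \<Rightarrow> real) \<Rightarrow> 'k \<Rightarrow> 'k \<Rightarrow> real" where
  "val_dist \<nu> a b = \<nu> (a - b)"

definition val_topology :: "('k::field \<Rightarrow> real) \<Rightarrow> 'k topology" where
  "val_topology \<nu> = Metric_space.mtopology UNIV (val_dist \<nu>)"

definition nontrivial_valuation :: "('k::field \<Rightarrow> real) \<Rightarrow> bool" where
  "nontrivial_valuation \<nu> \<longleftrightarrow> val_topology \<nu> \<noteq> discrete_topology UNIV"

text \<open>The metric completion, given up to isomorphism: a complete valuation field
  \<open>('h, \<nu>h)\<close> together with an isometric field embedding \<open>\<iota>\<close> of \<open>(K, \<nu>)\<close> with dense image.\<close>

locale valuation_completion =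
  base: valuation_field \<nu> + compl: valuation_field \<nu>h
  for \<nu> :: "'k::field \<Rightarrow> real" and \<nu>h :: "'h::field \<Rightarrow> real" +
  fixes \<iota> :: "'k \<Rightarrow> 'h"
  assumes embed_add: "\<iota> (a + b) = \<iota> a + \<iota> b"
    and embed_mult: "\<iota> (a * b) = \<iota> a * \<iota> b"
    and embed_one: "\<iota> 1 = 1"
    and embed_val: "\<nu>h (\<iota> a) = \<nu> a"
    and embed_dense: "val_topology \<nu>h closure_of (range \<iota>) = UNIV"
    and complete: "Metric_space.mcomplete UNIV (val_dist \<nu>h)"

lemma (in valuation_field) Metric_space_val_dist: "Metric_space UNIV (val_dist \<nu>)"
proof
  have m1: "\<nu> (-1) = 1"
  proof -
    have "\<nu> 1 = 1"
      using mult[of 1 1] eq_zero_iff[of 1] by simp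
    then have "(\<nu> (-1))\<^sup>2 = 1"
      using mult[of "-1" "-1"] by (simp add: power2_eq_square)
    then show ?thesis
      using nonneg[of "-1"] by (simp add: power2_eq_1_iff)
  qed
  fix x y z :: 'k
  show "0 \<le> val_dist \<nu> x y"
    by (simp add: val_dist_def nonneg)
  show "val_dist \<nu> x y = val_dist \<nu> y x"
    using mult[of "-1" "x - y"] m1 by (simp add: val_dist_def)
  show "val_dist \<nu> x y = 0 \<longleftrightarrow> x = y"
    by (simp add: val_dist_def eq_zero_iff)
  show "val_dist \<nu> x z \<le> val_dist \<nu> x y + val_dist \<nu> y z"
    using triangle[of "x - y" "y - z"] by (simp add: val_dist_def)
qed

section \<open>Compatible topologies\<close>

text \<open>The vector space is given by a carrier \<open>Z\<close>, an addition and a scalar multiplication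
  on it, since the tensor products below do not exhaust a type. \<open>F\<close> is the topology of the scalar field.\<close>

definition compatible_topologies ::
  "'a topology \<Rightarrow> 'z set \<Rightarrow> ('z \<Rightarrow> 'z \<Rightarrow> 'z) \<Rightarrow> ('a \<Rightarrow> 'z \<Rightarrow> 'z) \<Rightarrow> 'z topology set" where
  "compatible_topologies F Z pl sc =
    {T. topspace T = Z \<and>
        continuous_map (prod_topology T T) T (\<lambda>(x, y). pl x y) \<and>
        continuous_map (prod_topology F T) T (\<lambda>(a, x). sc a x)}"

definition max_compatible_topology ::
  "'a topology \<Rightarrow> 'z set \<Rightarrow> ('z \<Rightarrow> 'z \<Rightarrow> 'z) \<Rightarrow> ('a \<Rightarrow> 'z \<Rightarrow> 'z) \<Rightarrow> 'z topology" where
  "max_compatible_topology F Z pl sc =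
    (THE T. T \<in> compatible_topologies F Z pl sc \<and>
            (\<forall>S \<in> compatible_topologies F Z pl sc. \<forall>U. openin S U \<longrightarrow> openin T U))"

section \<open>Tensor products\<close>

text \<open>\<open>V \<otimes>\<^sub>K W\<close> is the quotient of the free abelian group on \<open>V \<times> W\<close> by the subgroup generated
  by the biadditivity and \<open>K\<close>-balancedness relators; \<open>sV\<close> and \<open>sW\<close> are the scalar multiplications by \<open>K\<close>.\<close>

inductive_set tensor_relations ::
  "('k \<Rightarrow> 'v \<Rightarrow> 'v) \<Rightarrow> ('k \<Rightarrow> 'w \<Rightarrow> 'w) \<Rightarrow> ('v::ab_group_add \<times> 'w::ab_group_add \<Rightarrow>\<^sub>0 int) set"
  for sV :: "'k \<Rightarrow> 'v \<Rightarrow> 'v" and sW :: "'k \<Rightarrow> 'w \<Rightarrow> 'w" where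
  add_left: "frag_of (v + v', w) - frag_of (v, w) - frag_of (v', w) \<in> tensor_relations sV sW"
| add_right: "frag_of (v, w + w') - frag_of (v, w) - frag_of (v, w') \<in> tensor_relations sV sW"
| balanced: "frag_of (sV a v, w) - frag_of (v, sW a w) \<in> tensor_relations sV sW"
| zero: "0 \<in> tensor_relations sV sW"
| diff: "p \<in> tensor_relations sV sW \<Longrightarrow> q \<in> tensor_relations sV sW \<Longrightarrow>
    p - q \<in> tensor_relations sV sW"

definition tensor_rel ::
  "('k \<Rightarrow> 'v \<Rightarrow> 'v) \<Rightarrow> ('k \<Rightarrow> 'w \<Rightarrow> 'w) \<Rightarrow> ('v::ab_group_add \<times> 'w::ab_group_add \<Rightarrow>\<^sub>0 int) rel" where
  "tensor_rel sV sW = {(p, q). p - q \<in> tensor_relations sV sW}"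

subsection \<open>Extension of scalars to the completion\<close>

type_synonym ('h, 'z) ext = "('h \<times> 'z \<Rightarrow>\<^sub>0 int) set"

text \<open>\<open>K\<close> acts on its completion through the embedding \<open>\<iota>\<close>.\<close>

definition ext_rel ::
  "('k \<Rightarrow> 'h) \<Rightarrow> ('k \<Rightarrow> 'z \<Rightarrow> 'z) \<Rightarrow> ('h::field \<times> 'z::ab_group_add \<Rightarrow>\<^sub>0 int) rel" where
  "ext_rel \<iota> s = tensor_rel (\<lambda>a h. \<iota> a * h) s"

definition ext_carrier ::
  "('k \<Rightarrow> 'h) \<Rightarrow> ('k \<Rightarrow> 'z \<Rightarrow> 'z) \<Rightarrow> ('h::field, 'z::ab_group_add) ext set" where
  "ext_carrier \<iota> s = UNIV // ext_rel \<iota> s"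

definition ext_tensor ::
  "('k \<Rightarrow> 'h) \<Rightarrow> ('k \<Rightarrow> 'z \<Rightarrow> 'z) \<Rightarrow> 'h \<Rightarrow> 'z \<Rightarrow> ('h::field, 'z::ab_group_add) ext" where
  "ext_tensor \<iota> s \<alpha> z = ext_rel \<iota> s `` {frag_of (\<alpha>, z)}"

definition ext_add ::
  "('k \<Rightarrow> 'h) \<Rightarrow> ('k \<Rightarrow> 'z \<Rightarrow> 'z) \<Rightarrow>
   ('h::field, 'z::ab_group_add) ext \<Rightarrow> ('h, 'z) ext \<Rightarrow> ('h, 'z) ext" where
  "ext_add \<iota> s A B = (\<Union>p\<in>A. \<Union>q\<in>B. ext_rel \<iota> s `` {p + q})"

text \<open>\<open>\<beta> \<cdot> (\<Sum>\<^sub>i \<alpha>\<^sub>i \<otimes> z\<^sub>i) = \<Sum>\<^sub>i (\<beta> \<alpha>\<^sub>i) \<otimes> z\<^sub>i\<close>\<close>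

definition ext_smult ::
  "('k \<Rightarrow> 'h) \<Rightarrow> ('k \<Rightarrow> 'z \<Rightarrow> 'z) \<Rightarrow>
   'h \<Rightarrow> ('h::field, 'z::ab_group_add) ext \<Rightarrow> ('h, 'z) ext" where
  "ext_smult \<iota> s \<beta> A =
    (\<Union>p\<in>A. ext_rel \<iota> s `` {frag_extend (\<lambda>(\<alpha>, z). frag_of (\<beta> * \<alpha>, z)) p})"

text \<open>Only the values on the carrier matter.\<close>

definition ext_linear ::
  "('k \<Rightarrow> 'h) \<Rightarrow> ('k \<Rightarrow> 'x \<Rightarrow> 'x) \<Rightarrow> ('k \<Rightarrow> 'y \<Rightarrow> 'y) \<Rightarrow>
   (('h::field, 'x::ab_group_add) ext \<Rightarrow> ('h, 'y::ab_group_add) ext) \<Rightarrow> bool" where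
  "ext_linear \<iota> sX sY M \<longleftrightarrow>
    M ` ext_carrier \<iota> sX \<subseteq> ext_carrier \<iota> sY \<and>
    (\<forall>A \<in> ext_carrier \<iota> sX. \<forall>B \<in> ext_carrier \<iota> sX.
       M (ext_add \<iota> sX A B) = ext_add \<iota> sY (M A) (M B)) \<and>
    (\<forall>\<beta>. \<forall>A \<in> ext_carrier \<iota> sX. M (ext_smult \<iota> sX \<beta> A) = ext_smult \<iota> sY \<beta> (M A))"

definition ext_max_topology ::
  "('h \<Rightarrow> real) \<Rightarrow> ('k \<Rightarrow> 'h) \<Rightarrow> ('k \<Rightarrow> 'z \<Rightarrow> 'z) \<Rightarrow> ('h::field, 'z::ab_group_add) ext topology" where
  "ext_max_topology \<nu>h \<iota> s =
    max_compatible_topology (val_topology \<nu>h) (ext_carrier \<iota> s) (ext_add \<iota> s) (ext_smult \<iota> s)"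

definition F_hat ::
  "('h \<Rightarrow> real) \<Rightarrow> ('k \<Rightarrow> 'h) \<Rightarrow> ('k \<Rightarrow> 'z \<Rightarrow> 'z) \<Rightarrow> 'z topology \<Rightarrow>
   ('h::field, 'z::ab_group_add) ext set" where
  "F_hat \<nu>h \<iota> s T =
    (\<Inter>U \<in> {U. openin T U \<and> 0 \<in> U}. ext_max_topology \<nu>h \<iota> s closure_of (ext_tensor \<iota> s 1 ` U))"

end

theory Submission
  imports Defs
begin

text \<open>
  A basis of \<open>Z\<close> identifies the scalar extension of \<open>Z\<close> with a space of coordinate vectors over the
  completion, whose largest compatible topology is that of the metric \<open>\<Sum>\<^sub>b \<nu>(x\<^sub>b - y\<^sub>b)\<close>.
  The point is that a compatible topology \<open>T\<close> on \<open>Z\<close> is determined by \<open>F_hat T\<close>: the sets of those \<open>z\<close>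
  for which \<open>1 \<otimes> z\<close> has distance less than \<open>\<epsilon>\<close> from \<open>F_hat T\<close> form a neighbourhood base of \<open>0\<close>.
  Every neighbourhood of \<open>0\<close> contains such a set because \<open>T\<close> is coarser than the metric topology
  of \<open>Z\<close>; that these sets are neighbourhoods uses the compactness of balls. Since the extended map is
  bounded for the metrics, both implications follow.
\<close>

section \<open>Valuation fields\<close>

context valuation_field
begin

sublocale val: Metric_space UNIV "val_dist \<nu>"
  by (rule Metric_space_val_dist)

lemma val_zero [simp]: "\<nu> 0 = 0"
  by (simp add: eq_zero_iff)

lemma val_one [simp]: "\<nu> 1 = 1"
  using mult[of 1 1] eq_zero_iff[of 1] by simp

lemma val_minus_commute: "\<nu> (a - b) = \<nu> (b - a)"
  using val.commute[of a b] by (simp add: val_dist_def)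

lemma val_minus [simp]: "\<nu> (- a) = \<nu> a"
  using val_minus_commute[of 0 a] by simp

lemma val_triangle_minus: "\<nu> (a - c) \<le> \<nu> (a - b) + \<nu> (b - c)"
  using triangle[of "a - b" "b - c"] by simp

lemma val_power: "\<nu> (a ^ n) = \<nu> a ^ n"
  by (induction n) (simp_all add: mult)

lemma val_inverse: "\<nu> (inverse a) = inverse (\<nu> a)"
proof (cases "a = 0")
  case False
  then have "\<nu> a * \<nu> (inverse a) = 1"
    by (simp flip: mult)
  then show ?thesis
    by (simp add: inverse_unique)
qed simp

lemma val_pos: "a \<noteq> 0 \<Longrightarrow> \<nu> a > 0"
  using nonneg[of a] eq_zero_iff[of a] by simp

lemma val_sum_le: "\<nu> (\<Sum>i\<in>I. f i) \<le> (\<Sum>i\<in>I. \<nu> (f i))"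
proof (induction I rule: infinite_finite_induct)
  case (insert i I)
  then show ?case
    using triangle[of "f i" "sum f I"] by simp
qed simp_all

text \<open>Otherwise every ball of radius 1 is a single point and the topology is discrete. The
  powers of \<open>t\<close> later serve as scalars tending to 0.\<close>

lemma nontrivial_obtains_small:
  assumes "nontrivial_valuation \<nu>"
  obtains t where "0 < \<nu> t" "\<nu> t < 1"
proof -
  have "\<exists>t. 0 < \<nu> t \<and> \<nu> t < 1"
  proof (rule ccontr)
    assume "\<nexists>t. 0 < \<nu> t \<and> \<nu> t < 1"
    then have "\<nu> (a - b) < 1 \<Longrightarrow> b = a" for a b
      using val_pos[of "a - b"] by (cases "a = b") auto
    then have "val.mball a 1 = {a}" for a
      by (auto simp: val_dist_def)
    then have "openin val.mtopology {a}" for a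
      by (metis val.openin_mball)
    then have "val.mtopology = discrete_topology UNIV"
      by (metis discrete_topology_unique val.topspace_mtopology)
    with assms show False
      by (simp add: nontrivial_valuation_def val_topology_def)
  qed
  with that show ?thesis
    by blast
qed

section \<open>Compatibility expressed through neighbourhoods\<close>

lemma compatible_topspace:
  "T \<in> compatible_topologies F Z pl sc \<Longrightarrow> topspace T = Z"
  by (simp add: compatible_topologies_def)

lemma compatible_add_nhds:
  assumes "T \<in> compatible_topologies F Z pl sc"
    and "openin T U" "x \<in> Z" "y \<in> Z" "pl x y \<in> U"
  obtains V W where "openin T V" "x \<in> V" "openin T W" "y \<in> W"
    "\<forall>v\<in>V. \<forall>w\<in>W. pl v w \<in> U"
proof -
  let ?P = "{p \<in> Z \<times> Z. (\<lambda>(x, y). pl x y) p \<in> U}"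
  have "continuous_map (prod_topology T T) T (\<lambda>(x, y). pl x y)" and T: "topspace T = Z"
    using assms(1) by (simp_all add: compatible_topologies_def)
  then have "openin (prod_topology T T) ?P"
    using openin_continuous_map_preimage[OF _ assms(2)] by fastforce
  moreover have "(x, y) \<in> ?P"
    using assms by simp
  ultimately obtain V W where "openin T V" "openin T W" "x \<in> V" "y \<in> W" "V \<times> W \<subseteq> ?P"
    unfolding openin_prod_topology_alt by meson
  then show ?thesis
    by (intro that[of V W]) auto
qed

lemma compatible_scale_nhds:
  assumes "T \<in> compatible_topologies (val_topology \<nu>) Z pl sc"
    and "openin T U" "x \<in> Z" "sc a x \<in> U"
  obtains \<delta> V where "\<delta> > 0" "openin T V" "x \<in> V"
    "\<forall>c. \<forall>y\<in>V. \<nu> (c - a) < \<delta> \<longrightarrow> sc c y \<in> U"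
proof -
  let ?P = "{p \<in> UNIV \<times> Z. (\<lambda>(a, x). sc a x) p \<in> U}"
  have "continuous_map (prod_topology val.mtopology T) T (\<lambda>(a, x). sc a x)" and T: "topspace T = Z"
    using assms(1) by (simp_all add: compatible_topologies_def val_topology_def)
  then have "openin (prod_topology val.mtopology T) ?P"
    using openin_continuous_map_preimage[OF _ assms(2)] by fastforce
  moreover have "(a, x) \<in> ?P"
    using assms by simp
  ultimately obtain A V where AV: "openin val.mtopology A" "openin T V" "a \<in> A" "x \<in> V"
      "A \<times> V \<subseteq> ?P"
    unfolding openin_prod_topology_alt by meson
  then obtain \<delta> where "\<delta> > 0" "val.mball a \<delta> \<subseteq> A"
    by (auto simp: val.openin_mtopology)
  moreover have "c \<in> val.mball a \<delta>" if "\<nu> (c - a) < \<delta>" for c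
    using that by (simp add: val_dist_def val_minus_commute)
  ultimately have "sc c y \<in> U" if "\<nu> (c - a) < \<delta>" "y \<in> V" for c y
    using that AV(5) by (metis (mono_tags, lifting) SigmaI case_prod_conv mem_Collect_eq subsetD)
  with \<open>\<delta> > 0\<close> AV show ?thesis
    by (intro that[of \<delta> V]) auto
qed

lemma compatible_scale_preimage:
  assumes "T \<in> compatible_topologies (val_topology \<nu>) Z pl sc" "openin T U"
  shows "openin T {x \<in> Z. sc a x \<in> U}"
  unfolding openin_subopen[of T "{x \<in> Z. sc a x \<in> U}"]
proof
  fix x
  assume x: "x \<in> {x \<in> Z. sc a x \<in> U}"
  obtain \<delta> V where *: "\<delta> > 0" "openin T V" "x \<in> V"
    "\<forall>c. \<forall>y\<in>V. \<nu> (c - a) < \<delta> \<longrightarrow> sc c y \<in> U"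
    using compatible_scale_nhds[OF assms, of x a] x by blast
  have "V \<subseteq> {x \<in> Z. sc a x \<in> U}"
    using * compatible_topspace[OF assms(1)] openin_subset[of T V] by auto
  with * show "\<exists>T'. openin T T' \<and> x \<in> T' \<and> T' \<subseteq> {x \<in> Z. sc a x \<in> U}"
    by blast
qed

text \<open>Local compactness provides a compact neighbourhood of 0. Multiplication by a fixed power
  of \<open>t\<close> carries the bounded sequence into it, and division by that power recovers the
  convergence.\<close>

lemma bounded_sequence_convergent_subsequence:
  assumes lc: "locally_compact_space (val_topology \<nu>)"
    and t: "0 < \<nu> t" "\<nu> t < 1"
    and R: "\<And>n::nat. \<nu> (\<sigma> n) \<le> R"
  obtains l r where "strict_mono (r :: nat \<Rightarrow> nat)" "(\<lambda>n. \<nu> (\<sigma> (r n) - l)) \<longlonglongrightarrow> 0"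
proof -
  obtain U C where U: "openin val.mtopology U" "0 \<in> U" "U \<subseteq> C" and C: "compactin val.mtopology C"
    using bspec[OF lc[unfolded locally_compact_space_def val_topology_def], of 0]
      val.topspace_mtopology by blast
  then obtain \<delta> where \<delta>: "\<delta> > 0" "val.mball 0 \<delta> \<subseteq> C"
    unfolding val.openin_mtopology by blast
  have "(\<lambda>m. \<nu> t ^ m * R) \<longlonglongrightarrow> 0 * R"
    by (intro tendsto_mult tendsto_const LIMSEQ_realpow_zero) (use t in auto)
  then have "\<forall>\<^sub>F m in sequentially. \<nu> t ^ m * R < \<delta>"
    using \<delta>(1) by (intro order_tendstoD(2)) auto
  then obtain m where m: "\<nu> t ^ m * R < \<delta>"
    by (auto simp: eventually_sequentially)
  define s where "s = t ^ m"
  have s: "\<nu> s > 0" "s \<noteq> 0" "\<nu> s * R < \<delta>"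
    using m t by (auto simp: s_def val_power)
  have "\<nu> (s * \<sigma> n) < \<delta>" for n
    using R[of n] s by (smt (verit, best) mult mult_left_mono)
  then have "range (\<lambda>n. s * \<sigma> n) \<subseteq> C"
    using \<delta> by (auto simp: val.mball_def val_dist_def)
  then obtain l r where r: "strict_mono r" "limitin val.mtopology ((\<lambda>n. s * \<sigma> n) \<circ> r) l sequentially"
    using C unfolding val.compactin_sequentially by blast
  then have "(\<lambda>n. \<nu> (s * \<sigma> (r n) - l)) \<longlonglongrightarrow> 0"
    by (simp add: val.limitin_metric_dist_null val_dist_def)
  then have "(\<lambda>n. inverse (\<nu> s) * \<nu> (s * \<sigma> (r n) - l)) \<longlonglongrightarrow> inverse (\<nu> s) * 0"
    by (intro tendsto_mult tendsto_const)
  moreover have "inverse (\<nu> s) * \<nu> (s * \<sigma> (r n) - l) = \<nu> (\<sigma> (r n) - inverse s * l)" for n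
  proof -
    have "inverse s * (s * \<sigma> (r n) - l) = \<sigma> (r n) - inverse s * l"
      using s by (simp add: right_diff_distrib flip: mult.assoc)
    then show ?thesis
      by (metis mult val_inverse)
  qed
  ultimately show ?thesis
    using r by (intro that[of r "inverse s * l"]) auto
qed

end

section \<open>Spaces with coordinates\<close>

text \<open>One locale serves twice: for \<open>Z\<close> over \<open>K\<close> and for its scalar
  extension over the completion. Identities between vectors are read off from coordinates, since
  \<open>\<phi>\<close> is injective on \<open>E\<close>.\<close>

locale coordinate_space = valuation_field \<nu>
  for \<nu> :: "'f::field \<Rightarrow> real" +
  fixes E :: "'e set"
    and pl :: "'e \<Rightarrow> 'e \<Rightarrow> 'e"
    and sc :: "'f \<Rightarrow> 'e \<Rightarrow> 'e"
    and B :: "'i set"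
    and \<phi> :: "'e \<Rightarrow> 'i \<Rightarrow> 'f"
  assumes finite_B: "finite B"
    and bij_coord: "bij_betw \<phi> E {v. \<forall>b. b \<notin> B \<longrightarrow> v b = 0}"
    and pl_closed: "x \<in> E \<Longrightarrow> y \<in> E \<Longrightarrow> pl x y \<in> E"
    and sc_closed: "x \<in> E \<Longrightarrow> sc a x \<in> E"
    and coord_pl: "x \<in> E \<Longrightarrow> y \<in> E \<Longrightarrow> \<phi> (pl x y) b = \<phi> x b + \<phi> y b"
    and coord_sc: "x \<in> E \<Longrightarrow> \<phi> (sc a x) b = a * \<phi> x b"
begin

definition cdist :: "'e \<Rightarrow> 'e \<Rightarrow> real" where
  "cdist x y = (\<Sum>b\<in>B. \<nu> (\<phi> x b - \<phi> y b))"

lemma coord_outside: "x \<in> E \<Longrightarrow> b \<notin> B \<Longrightarrow> \<phi> x b = 0"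
  using bij_coord by (auto simp: bij_betw_def)

lemma coord_eqI:
  assumes "x \<in> E" "y \<in> E" "\<And>b. b \<in> B \<Longrightarrow> \<phi> x b = \<phi> y b"
  shows "x = y"
proof -
  have "\<phi> x = \<phi> y"
    using assms coord_outside by (intro ext) metis
  then show ?thesis
    using bij_coord assms by (auto simp: bij_betw_def inj_on_def)
qed

lemma coord_obtains:
  assumes "\<And>b. b \<notin> B \<Longrightarrow> v b = 0"
  obtains x where "x \<in> E" "\<phi> x = v"
proof -
  have "v \<in> \<phi> ` E"
    using bij_coord assms by (auto simp: bij_betw_def)
  with that show ?thesis
    by blast
qed

section \<open>The sum metric and the vector operations\<close>

lemma cdist_triangle: "cdist x z \<le> cdist x y + cdist y z"
  unfolding cdist_def sum.distrib[symmetric] by (intro sum_mono val_triangle_minus)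

lemma Metric_space_cdist: "Metric_space E cdist"
proof
  fix x y z
  show "0 \<le> cdist x y"
    by (simp add: cdist_def nonneg sum_nonneg)
  show "cdist x y = cdist y x"
    by (simp add: cdist_def val_minus_commute)
  show "cdist x y = 0 \<longleftrightarrow> x = y" if "x \<in> E" "y \<in> E"
    using that coord_eqI[of x y]
    by (auto simp: cdist_def sum_nonneg_eq_0_iff finite_B nonneg eq_zero_iff)
  show "cdist x z \<le> cdist x y + cdist y z"
    by (rule cdist_triangle)
qed

sublocale crd: Metric_space E cdist
  by (rule Metric_space_cdist)

lemma val_coord_le_cdist: "b \<in> B \<Longrightarrow> \<nu> (\<phi> x b - \<phi> y b) \<le> cdist x y"
  unfolding cdist_def
  using member_le_sum[of b B "\<lambda>b. \<nu> (\<phi> x b - \<phi> y b)"] finite_B nonneg by auto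

lemma cdist_pl:
  assumes "x \<in> E" "y \<in> E" "x' \<in> E" "y' \<in> E"
  shows "cdist (pl x y) (pl x' y') \<le> cdist x x' + cdist y y'"
  unfolding cdist_def sum.distrib[symmetric]
proof (intro sum_mono)
  show "\<nu> (\<phi> (pl x y) b - \<phi> (pl x' y') b) \<le> \<nu> (\<phi> x b - \<phi> x' b) + \<nu> (\<phi> y b - \<phi> y' b)" for b
    using assms triangle[of "\<phi> x b - \<phi> x' b" "\<phi> y b - \<phi> y' b"]
    by (simp add: coord_pl algebra_simps)
qed

lemma cdist_sc:
  assumes "x \<in> E" "y \<in> E"
  shows "cdist (sc a x) (sc a y) = \<nu> a * cdist x y"
  using assms by (simp add: cdist_def coord_sc sum_distrib_left flip: right_diff_distrib mult)

text \<open>Rests on a x - c y = (a - c) x + c (x - y). Replacing \<nu> c by \<nu> a + \<nu> (a - c)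
  leaves a bound in terms of the point (a, x) and the two distances from it, as continuity at (a, x)
  requires.\<close>

lemma cdist_sc_sc:
  assumes "x \<in> E" "y \<in> E"
  shows "cdist (sc a x) (sc c y)
    \<le> \<nu> (a - c) * (\<Sum>b\<in>B. \<nu> (\<phi> x b)) + (\<nu> a + \<nu> (a - c)) * cdist x y"
  unfolding cdist_def sum_distrib_left sum.distrib[symmetric]
proof (intro sum_mono)
  fix b
  have "\<phi> (sc a x) b - \<phi> (sc c y) b = (a - c) * \<phi> x b + c * (\<phi> x b - \<phi> y b)"
    using assms by (simp add: coord_sc algebra_simps)
  then have "\<nu> (\<phi> (sc a x) b - \<phi> (sc c y) b)
      \<le> \<nu> (a - c) * \<nu> (\<phi> x b) + \<nu> c * \<nu> (\<phi> x b - \<phi> y b)"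
    by (metis mult triangle)
  also have "\<nu> c * \<nu> (\<phi> x b - \<phi> y b) \<le> (\<nu> a + \<nu> (a - c)) * \<nu> (\<phi> x b - \<phi> y b)"
    using triangle[of a "c - a"] val_minus_commute[of a c]
    by (intro mult_right_mono nonneg) simp
  finally show "\<nu> (\<phi> (sc a x) b - \<phi> (sc c y) b)
      \<le> \<nu> (a - c) * \<nu> (\<phi> x b) + (\<nu> a + \<nu> (a - c)) * \<nu> (\<phi> x b - \<phi> y b)"
    by simp
qed

text \<open>The metric is translation invariant, so a multiple of \<open>y\<close> can be moved to
  the other side. In \<open>emb_near_F_hat\<close> this trades moving a point along
  \<open>F_hat\<close> for moving the points of \<open>F_hat\<close>.\<close>

lemma cdist_pl_sc:
  assumes "x \<in> E" "y \<in> E" "z \<in> E"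
  shows "cdist (pl x (sc (- a) y)) z = cdist x (pl z (sc a y))"
  using assms by (simp add: cdist_def coord_pl coord_sc sc_closed algebra_simps)

lemma mtopology_compatible:
  "crd.mtopology \<in> compatible_topologies (val_topology \<nu>) E pl sc"
proof -
  have "continuous_map (prod_topology crd.mtopology crd.mtopology) crd.mtopology (\<lambda>(x, y). pl x y)"
    unfolding crd.continuous_map_to_metric
  proof (intro ballI allI impI)
    fix p and \<epsilon> :: real
    assume "p \<in> topspace (prod_topology crd.mtopology crd.mtopology)" and \<epsilon>: "\<epsilon> > 0"
    then obtain x y where p: "p = (x, y)" "x \<in> E" "y \<in> E"
      by auto
    let ?W = "crd.mball x (\<epsilon>/2) \<times> crd.mball y (\<epsilon>/2)"
    have "openin (prod_topology crd.mtopology crd.mtopology) ?W"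
      by (simp add: openin_prod_Times_iff)
    moreover have "(\<lambda>(x, y). pl x y) q \<in> crd.mball ((\<lambda>(x, y). pl x y) p) \<epsilon>" if "q \<in> ?W" for q
      using that p pl_closed cdist_pl by fastforce
    ultimately show "\<exists>U. openin (prod_topology crd.mtopology crd.mtopology) U \<and> p \<in> U \<and>
        (\<forall>q\<in>U. (\<lambda>(x, y). pl x y) q \<in> crd.mball ((\<lambda>(x, y). pl x y) p) \<epsilon>)"
      using p \<epsilon> by (intro exI[of _ ?W]) auto
  qed
  moreover have "continuous_map (prod_topology val.mtopology crd.mtopology) crd.mtopology (\<lambda>(a, x). sc a x)"
    unfolding crd.continuous_map_to_metric
  proof (intro ballI allI impI)
    fix p and \<epsilon> :: real
    assume "p \<in> topspace (prod_topology val.mtopology crd.mtopology)" and \<epsilon>: "\<epsilon> > 0"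
    then obtain a x where p: "p = (a, x)" "x \<in> E"
      by auto
    \<comment> \<open>\<open>\<delta> * N\<close> bounds the estimate of \<open>cdist_sc_sc\<close>:
      the summand 1 absorbs \<nu> (a - c), which stays below \<delta> \<le> 1, and it makes
      \<open>N\<close> positive.\<close>
    define N where "N = (\<Sum>b\<in>B. \<nu> (\<phi> x b)) + \<nu> a + 1"
    have N: "N > 0"
      unfolding N_def by (smt (verit) nonneg sum_nonneg)
    define \<delta> where "\<delta> = min 1 (\<epsilon> / N)"
    have \<delta>: "\<delta> > 0" "\<delta> \<le> 1" "\<delta> * N \<le> \<epsilon>"
      using N \<epsilon> by (auto simp: \<delta>_def min_def field_simps)
    let ?W = "val.mball a \<delta> \<times> crd.mball x \<delta>"
    have "openin (prod_topology val.mtopology crd.mtopology) ?W"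
      by (simp add: openin_prod_Times_iff)
    moreover have "(\<lambda>(a, x). sc a x) q \<in> crd.mball ((\<lambda>(a, x). sc a x) p) \<epsilon>" if "q \<in> ?W" for q
    proof -
      obtain c y where q: "q = (c, y)" "y \<in> E" "\<nu> (a - c) < \<delta>" "cdist x y < \<delta>"
        using \<open>q \<in> ?W\<close> by (auto simp: val_dist_def)
      have "cdist (sc a x) (sc c y)
          \<le> \<nu> (a - c) * (\<Sum>b\<in>B. \<nu> (\<phi> x b)) + (\<nu> a + \<nu> (a - c)) * cdist x y"
        by (rule cdist_sc_sc[OF p(2) q(2)])
      also have "\<nu> (a - c) * (\<Sum>b\<in>B. \<nu> (\<phi> x b)) \<le> \<delta> * (\<Sum>b\<in>B. \<nu> (\<phi> x b))"
        using q by (intro mult_right_mono sum_nonneg nonneg) simp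
      also have "(\<nu> a + \<nu> (a - c)) * cdist x y \<le> (\<nu> a + \<nu> (a - c)) * \<delta>"
        using q nonneg by (intro mult_left_mono) auto
      also have "(\<nu> a + \<nu> (a - c)) * \<delta> < (\<nu> a + 1) * \<delta>"
        using q \<delta> by (intro mult_strict_right_mono) auto
      also have "\<delta> * (\<Sum>b\<in>B. \<nu> (\<phi> x b)) + (\<nu> a + 1) * \<delta> = \<delta> * N"
        by (simp add: N_def algebra_simps)
      finally show ?thesis
        using \<delta> p q sc_closed by simp
    qed
    ultimately show "\<exists>U. openin (prod_topology val.mtopology crd.mtopology) U \<and> p \<in> U \<and>
        (\<forall>q\<in>U. (\<lambda>(a, x). sc a x) q \<in> crd.mball ((\<lambda>(a, x). sc a x) p) \<epsilon>)"
      using p \<delta>(1) by (intro exI[of _ ?W]) auto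
  qed
  ultimately show ?thesis
    by (simp add: compatible_topologies_def val_topology_def)
qed

text \<open>Induction on the set \<open>D\<close> of coordinates in which y may differ from x. A
  further coordinate b contributes a multiple h e of a unit vector. Continuity of scalar
  multiplication at (0, e) keeps h e in a prescribed neighbourhood of 0 for small h, and continuity
  of addition at (0, x) combines it with the induction hypothesis.\<close>

lemma compatible_open_contains_box:
  assumes S: "S \<in> compatible_topologies (val_topology \<nu>) E pl sc" and "D \<subseteq> B"
    and "openin S U" "x \<in> U"
  shows "\<exists>\<epsilon>>0. \<forall>y\<in>E. (\<forall>b. b \<notin> D \<longrightarrow> \<phi> y b = \<phi> x b) \<and> (\<forall>b\<in>D. \<nu> (\<phi> y b - \<phi> x b) < \<epsilon>)
    \<longrightarrow> y \<in> U"
  using finite_subset[OF \<open>D \<subseteq> B\<close> finite_B] assms(2-)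
proof (induction D arbitrary: U rule: finite_induct)
  case empty
  then have "x \<in> E"
    using openin_subset[of S U] compatible_topspace[OF S] by auto
  have "y = x" if "y \<in> E" "\<forall>b. \<phi> y b = \<phi> x b" for y
    using coord_eqI[OF that(1) \<open>x \<in> E\<close>] that(2) by blast
  with empty show ?case
    by (intro exI[of _ 1]) auto
next
  case (insert b D)
  then have x: "x \<in> E"
    using openin_subset[of S U] compatible_topspace[OF S] by auto
  obtain e where e: "e \<in> E" "\<phi> e = (\<lambda>i. if i = b then 1 else 0)"
    by (rule coord_obtains[of "\<lambda>i. if i = b then 1 else 0"]) (use insert.prems(1) in auto)
  have se: "sc 0 e \<in> E"
    by (rule sc_closed[OF e(1)])
  have "pl (sc 0 e) x = x"
    by (rule coord_eqI) (use x e in \<open>auto simp: pl_closed sc_closed coord_pl coord_sc\<close>)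
  then have mem: "pl (sc 0 e) x \<in> U"
    using insert.prems by simp
  obtain A U' where A: "openin S A" "sc 0 e \<in> A" and U': "openin S U'" "x \<in> U'"
    and AU': "\<forall>v\<in>A. \<forall>w\<in>U'. pl v w \<in> U"
    by (rule compatible_add_nhds[OF S insert.prems(2) se x mem])
  obtain \<delta> V where \<delta>: "\<delta> > 0" "openin S V" "e \<in> V"
      "\<forall>c. \<forall>y\<in>V. \<nu> (c - 0) < \<delta> \<longrightarrow> sc c y \<in> A"
    by (rule compatible_scale_nhds[OF S A(1) e(1) A(2)])
  obtain \<epsilon> where \<epsilon>: "\<epsilon> > 0"
    "\<And>y. y \<in> E \<Longrightarrow> \<forall>i. i \<notin> D \<longrightarrow> \<phi> y i = \<phi> x i \<Longrightarrow> \<forall>i\<in>D. \<nu> (\<phi> y i - \<phi> x i) < \<epsilon> \<Longrightarrow> y \<in> U'"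
    using insert.IH[OF _ U'] insert.prems by blast
  have "y \<in> U" if y: "y \<in> E" "\<forall>i. i \<notin> insert b D \<longrightarrow> \<phi> y i = \<phi> x i"
      "\<forall>i\<in>insert b D. \<nu> (\<phi> y i - \<phi> x i) < min \<delta> \<epsilon>" for y
  proof -
    define h where "h = \<phi> y b - \<phi> x b"
    \<comment> \<open>\<open>z\<close> is \<open>y\<close> with its coordinate at \<open>b\<close>
      reset to that of \<open>x\<close>, so the induction hypothesis covers it.\<close>
    define z where "z = pl (sc (- h) e) y"
    have z: "z \<in> E"
      using y e by (simp add: z_def pl_closed sc_closed)
    have \<phi>z: "\<phi> z i = (if i = b then \<phi> x i else \<phi> y i)" for i
      using y e by (simp add: z_def coord_pl coord_sc sc_closed h_def)
    have "z \<in> U'"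
      using z y insert.hyps by (intro \<epsilon>(2)) (auto simp: \<phi>z)
    moreover have "sc h e \<in> A"
      using \<delta> y by (simp add: h_def)
    moreover have "pl (sc h e) z = y"
      by (rule coord_eqI) (use y e z in \<open>auto simp: pl_closed sc_closed coord_pl coord_sc \<phi>z h_def\<close>)
    ultimately show ?thesis
      using AU' by metis
  qed
  then show ?case
    using \<delta>(1) \<epsilon>(1) by (intro exI[of _ "min \<delta> \<epsilon>"]) auto
qed

lemma compatible_open_contains_ball:
  assumes S: "S \<in> compatible_topologies (val_topology \<nu>) E pl sc"
    and U: "openin S U" "x \<in> U"
  obtains \<epsilon> where "\<epsilon> > 0" "crd.mball x \<epsilon> \<subseteq> U"
proof -
  obtain \<epsilon> where \<epsilon>: "\<epsilon> > 0"
    "\<And>y. y \<in> E \<Longrightarrow> \<forall>b. b \<notin> B \<longrightarrow> \<phi> y b = \<phi> x b \<Longrightarrow> \<forall>b\<in>B. \<nu> (\<phi> y b - \<phi> x b) < \<epsilon> \<Longrightarrow> y \<in> U"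
    using compatible_open_contains_box[OF S order.refl U] by blast
  have "y \<in> U" if "y \<in> crd.mball x \<epsilon>" for y
    using that val_coord_le_cdist[of _ y x] crd.commute[of x y] coord_outside
    by (intro \<epsilon>(2)) (auto intro: le_less_trans)
  with \<epsilon>(1) show ?thesis
    by (intro that) auto
qed

text \<open>By \<open>compatible_open_contains_ball\<close> each compatible topology is coarser than
  the metric one, which is itself compatible. Two largest elements coincide, so \<open>THE\<close>
  describes a unique topology.\<close>

lemma max_compatible_topology_eq:
  "max_compatible_topology (val_topology \<nu>) E pl sc = crd.mtopology"
  unfolding max_compatible_topology_def
proof (rule the_equality)
  have finer: "openin crd.mtopology U"
    if S: "S \<in> compatible_topologies (val_topology \<nu>) E pl sc" and "openin S U" for S U
    unfolding crd.openin_mtopology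
    using that compatible_open_contains_ball[OF that] compatible_topspace[OF S] openin_subset[of S U]
    by metis
  then show "crd.mtopology \<in> compatible_topologies (val_topology \<nu>) E pl sc \<and>
      (\<forall>S\<in>compatible_topologies (val_topology \<nu>) E pl sc. \<forall>U. openin S U \<longrightarrow> openin crd.mtopology U)"
    using mtopology_compatible by blast
  show "T = crd.mtopology" if "T \<in> compatible_topologies (val_topology \<nu>) E pl sc \<and>
      (\<forall>S\<in>compatible_topologies (val_topology \<nu>) E pl sc. \<forall>U. openin S U \<longrightarrow> openin T U)" for T
    using that finer mtopology_compatible unfolding topology_eq by blast
qed

text \<open>One coordinate after another, with a further subsequence each time; convergence in the
  coordinates already treated persists along subsequences.\<close>

lemma bounded_coordinates_convergent_subsequence:
  fixes \<sigma> :: "nat \<Rightarrow> 'i \<Rightarrow> 'f"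
  assumes lc: "locally_compact_space (val_topology \<nu>)"
    and t: "0 < \<nu> t" "\<nu> t < 1"
    and "finite D" and "\<And>n b. b \<in> D \<Longrightarrow> \<nu> (\<sigma> n b) \<le> R"
  shows "\<exists>l r. strict_mono (r :: nat \<Rightarrow> nat) \<and> (\<forall>b\<in>D. (\<lambda>n. \<nu> (\<sigma> (r n) b - l b)) \<longlonglongrightarrow> 0)"
  using assms(4-)
proof (induction D rule: finite_induct)
  case empty
  show ?case
    by (auto intro: exI[of _ id] strict_mono_id)
next
  case (insert b D)
  then obtain l r where r: "strict_mono (r :: nat \<Rightarrow> nat)"
    and l: "\<And>i. i \<in> D \<Longrightarrow> (\<lambda>n. \<nu> (\<sigma> (r n) i - l i)) \<longlonglongrightarrow> 0"
    by (metis insertCI)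
  have bounded: "\<nu> (\<sigma> (r n) b) \<le> R" for n
    using insert.prems by simp
  obtain r' l' where r': "strict_mono (r' :: nat \<Rightarrow> nat)"
    and l': "(\<lambda>n. \<nu> (\<sigma> (r (r' n)) b - l')) \<longlonglongrightarrow> 0"
    by (rule bounded_sequence_convergent_subsequence[OF lc t bounded])
  have "(\<lambda>n. \<nu> (\<sigma> (r (r' n)) i - (l(b := l')) i)) \<longlonglongrightarrow> 0" if "i \<in> insert b D" for i
    using that l' LIMSEQ_subseq_LIMSEQ[OF l[of i] r'] by (auto simp: o_def)
  then show ?case
    using strict_mono_o[OF r r']
    by (intro exI[of _ "l(b := l')"] exI[of _ "r \<circ> r'"]) (simp add: o_def)
qed

text \<open>Coordinates relative to the centre are bounded by \<open>R\<close>, so a subsequence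
  converges in each of the finitely many coordinates, hence in the sum metric. The ball is closed
  and keeps the limit.\<close>

lemma compactin_mcball:
  assumes lc: "locally_compact_space (val_topology \<nu>)"
    and t: "0 < \<nu> t" "\<nu> t < 1"
    and x: "x \<in> E"
  shows "compactin crd.mtopology (crd.mcball x R)"
  unfolding crd.compactin_sequentially
proof (intro conjI allI impI)
  show "crd.mcball x R \<subseteq> E"
    by (rule crd.mcball_subset_mspace)
  fix \<sigma> :: "nat \<Rightarrow> 'e"
  assume "range \<sigma> \<subseteq> crd.mcball x R"
  then have \<sigma>: "\<sigma> n \<in> E" "cdist x (\<sigma> n) \<le> R" for n
    by (meson crd.in_mcball range_subsetD)+
  have "\<nu> (\<phi> (\<sigma> n) b - \<phi> x b) \<le> R" if "b \<in> B" for n b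
    using val_coord_le_cdist[OF that, of "\<sigma> n" x] \<sigma>[of n] crd.commute[of x "\<sigma> n"] by simp
  then obtain l r where r: "strict_mono (r :: nat \<Rightarrow> nat)"
    and l: "\<And>b. b \<in> B \<Longrightarrow> (\<lambda>n. \<nu> (\<phi> (\<sigma> (r n)) b - \<phi> x b - l b)) \<longlonglongrightarrow> 0"
    using bounded_coordinates_convergent_subsequence
      [OF lc t finite_B, of "\<lambda>n b. \<phi> (\<sigma> n) b - \<phi> x b" R] by blast
  obtain y where y: "y \<in> E" "\<phi> y = (\<lambda>b. if b \<in> B then l b + \<phi> x b else 0)"
    using coord_obtains[of "\<lambda>b. if b \<in> B then l b + \<phi> x b else 0"] by auto
  have "(\<lambda>n. \<Sum>b\<in>B. \<nu> (\<phi> (\<sigma> (r n)) b - \<phi> y b)) \<longlonglongrightarrow> (\<Sum>b\<in>B. 0)"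
    using l by (intro tendsto_sum) (simp add: y algebra_simps)
  then have lim: "limitin crd.mtopology (\<sigma> \<circ> r) y sequentially"
    using y \<sigma> by (simp add: crd.limitin_metric_dist_null cdist_def)
  then have "y \<in> crd.mcball x R"
    by (rule limitin_closedin) (use \<sigma> x in auto)
  with r lim show "\<exists>l r. l \<in> crd.mcball x R \<and> strict_mono r \<and>
      limitin crd.mtopology (\<sigma> \<circ> r) l sequentially"
    by blast
qed

end

section \<open>Coordinates on the scalar extension\<close>

text \<open>The homomorphism on the free abelian group that extends \<open>g\<close> from the
  generators.\<close>

definition frag_eval :: "('a \<Rightarrow> 'r::ring_1) \<Rightarrow> ('a \<Rightarrow>\<^sub>0 int) \<Rightarrow> 'r" where
  "frag_eval g p = (\<Sum>k\<in>Poly_Mapping.keys p. of_int (poly_mapping.lookup p k) * g k)"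

lemma frag_eval_superset:
  assumes "finite S" "Poly_Mapping.keys p \<subseteq> S"
  shows "frag_eval g p = (\<Sum>k\<in>S. of_int (poly_mapping.lookup p k) * g k)"
  unfolding frag_eval_def using assms by (intro sum.mono_neutral_left) (auto simp: in_keys_iff)

lemma frag_eval_of [simp]: "frag_eval g (frag_of k) = g k"
  by (simp add: frag_eval_def)

lemma frag_eval_zero [simp]: "frag_eval g 0 = 0"
  by (simp add: frag_eval_def)

lemma frag_eval_diff: "frag_eval g (p - q) = frag_eval g p - frag_eval g q"
proof -
  let ?S = "Poly_Mapping.keys p \<union> Poly_Mapping.keys q"
  have "frag_eval g (p - q) = (\<Sum>k\<in>?S. of_int (poly_mapping.lookup (p - q) k) * g k)"
    by (rule frag_eval_superset) (auto simp: keys_diff)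
  also have "\<dots> = frag_eval g p - frag_eval g q"
    by (simp add: frag_eval_superset[of ?S] lookup_minus left_diff_distrib flip: sum_subtractf)
  finally show ?thesis .
qed

lemma frag_eval_add: "frag_eval g (p + q) = frag_eval g p + frag_eval g q"
  using frag_eval_diff[of g "p + q" q] by simp

lemma frag_eval_sum: "frag_eval g (\<Sum>i\<in>I. p i) = (\<Sum>i\<in>I. frag_eval g (p i))"
  by (induction I rule: infinite_finite_induct) (simp_all add: frag_eval_add)

section \<open>The subgroup of tensor relators\<close>

lemma tensor_relations_uminus: "p \<in> tensor_relations sV sW \<Longrightarrow> - p \<in> tensor_relations sV sW"
  using tensor_relations.diff[OF tensor_relations.zero] by fastforce

lemma tensor_relations_add:
  "p \<in> tensor_relations sV sW \<Longrightarrow> q \<in> tensor_relations sV sW \<Longrightarrow> p + q \<in> tensor_relations sV sW"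
  using tensor_relations.diff[OF _ tensor_relations_uminus] by fastforce

lemma tensor_relations_sum:
  "(\<And>i. i \<in> I \<Longrightarrow> p i \<in> tensor_relations sV sW) \<Longrightarrow> (\<Sum>i\<in>I. p i) \<in> tensor_relations sV sW"
  by (induction I rule: infinite_finite_induct)
    (auto intro: tensor_relations_add tensor_relations.zero)

lemma tensor_relations_sum_right:
  "finite I \<Longrightarrow>
    frag_of (v, \<Sum>i\<in>I. w i) - (\<Sum>i\<in>I. frag_of (v, w i)) \<in> tensor_relations sV sW"
proof (induction I rule: finite_induct)
  case empty
  show ?case
    \<comment> \<open>The relator for \<open>0 + 0\<close> is
      \<open>- frag_of (v, 0)\<close>.\<close>
    using tensor_relations_uminus[OF tensor_relations.add_right[of v 0 0 sV sW]] by simp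
next
  case (insert i I)
  have "(frag_of (v, w i + sum w I) - frag_of (v, w i) - frag_of (v, sum w I))
      + (frag_of (v, sum w I) - (\<Sum>i\<in>I. frag_of (v, w i))) \<in> tensor_relations sV sW"
    using insert by (intro tensor_relations_add tensor_relations.add_right)
  with insert show ?case
    by (simp add: algebra_simps)
qed

context valuation_completion
begin

lemma embed_zero [simp]: "\<iota> 0 = 0"
  by (metis add_0 add_cancel_right_right embed_add)

lemma embed_diff: "\<iota> (a - b) = \<iota> a - \<iota> b"
  using embed_add[of "a - b" b] by (simp add: algebra_simps)

lemma embed_minus: "\<iota> (- a) = - \<iota> a"
  using embed_diff[of 0 a] by simp

lemma embed_sum: "\<iota> (\<Sum>i\<in>I. f i) = (\<Sum>i\<in>I. \<iota> (f i))"
  by (induction I rule: infinite_finite_induct) (simp_all add: embed_add)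

end

locale scalar_extension = valuation_completion \<nu> \<nu>h \<iota> + finite_dimensional_vector_space s Basis
  for \<nu> :: "'k::field \<Rightarrow> real" and \<nu>h :: "'h::field \<Rightarrow> real" and \<iota> :: "'k \<Rightarrow> 'h"
    and s :: "'k \<Rightarrow> 'z::ab_group_add \<Rightarrow> 'z" and Basis :: "'z set"
begin

abbreviation coord :: "'z \<Rightarrow> 'z \<Rightarrow> 'k" where
  "coord \<equiv> representation Basis"

lemma coord_add: "coord (x + y) b = coord x b + coord y b"
  by (simp add: representation_add independent_Basis span_Basis)

lemma coord_scale: "coord (s a x) b = a * coord x b"
  by (simp add: representation_scale independent_Basis span_Basis)

lemma sum_coord: "(\<Sum>b\<in>Basis. s (coord z b) b) = z"
  by (rule sum_representation_eq) (simp_all add: independent_Basis span_Basis finite_Basis)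

lemma coord_sum_Basis:
  assumes "c \<in> Basis"
  shows "coord (\<Sum>b\<in>Basis. s (v b) b) c = v c"
proof -
  have "coord (\<Sum>b\<in>Basis. s (v b) b) c = (\<Sum>b\<in>Basis. v b * coord b c)"
    by (simp add: representation_sum independent_Basis span_Basis representation_scale)
  also have "\<dots> = (\<Sum>b\<in>Basis. if b = c then v b else 0)"
    by (intro sum.cong) (auto simp: representation_basis independent_Basis)
  finally show ?thesis
    using assms by (simp add: finite_Basis)
qed

lemma coord_outside: "b \<notin> Basis \<Longrightarrow> coord z b = 0"
  using representation_ne_zero by blast

sublocale scl: coordinate_space \<nu> UNIV "(+)" s Basis coord
proof
  show "bij_betw coord UNIV {v. \<forall>b. b \<notin> Basis \<longrightarrow> v b = 0}"
    unfolding bij_betw_def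
  proof (intro conjI injI equalityI subsetI)
    show "x = y" if "coord x = coord y" for x y
      using that sum_coord by metis
    show "v \<in> range coord" if "v \<in> {v. \<forall>b. b \<notin> Basis \<longrightarrow> v b = 0}" for v
    proof
      show "v = coord (\<Sum>b\<in>Basis. s (v b) b)"
      proof
        show "v c = coord (\<Sum>b\<in>Basis. s (v b) b) c" for c
          using that coord_sum_Basis[of c v] coord_outside[of c] by (cases "c \<in> Basis") auto
      qed
    qed simp
  qed (auto simp: coord_outside)
qed (simp_all add: finite_Basis coord_add coord_scale)

text \<open>The coordinate along 1 \<otimes> b of the tensor represented by \<open>p\<close>,
  defined on representatives first.\<close>

definition frag_coord :: "('h \<times> 'z \<Rightarrow>\<^sub>0 int) \<Rightarrow> 'z \<Rightarrow> 'h" where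
  "frag_coord p b = frag_eval (\<lambda>(\<alpha>, z). \<alpha> * \<iota> (coord z b)) p"

abbreviation relations :: "('h \<times> 'z \<Rightarrow>\<^sub>0 int) set" where
  "relations \<equiv> tensor_relations (\<lambda>a h. \<iota> a * h) s"

lemma frag_coord_of [simp]: "frag_coord (frag_of (\<alpha>, z)) b = \<alpha> * \<iota> (coord z b)"
  by (simp add: frag_coord_def)

lemma frag_coord_zero [simp]: "frag_coord 0 b = 0"
  by (simp add: frag_coord_def)

lemma frag_coord_diff: "frag_coord (p - q) b = frag_coord p b - frag_coord q b"
  by (simp add: frag_coord_def frag_eval_diff)

lemma frag_coord_add: "frag_coord (p + q) b = frag_coord p b + frag_coord q b"
  by (simp add: frag_coord_def frag_eval_add)

lemma frag_coord_sum: "frag_coord (\<Sum>i\<in>I. p i) b = (\<Sum>i\<in>I. frag_coord (p i) b)"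
  by (simp add: frag_coord_def frag_eval_sum)

lemma frag_coord_outside: "b \<notin> Basis \<Longrightarrow> frag_coord p b = 0"
  by (simp add: frag_coord_def frag_eval_def case_prod_unfold coord_outside)

text \<open>The map from (\<alpha>, z) to \<open>\<alpha> * \<iota> (coord z b)\<close> is
  biadditive and balanced, hence kills every relator. Coordinates therefore descend to
  classes.\<close>

lemma frag_coord_relations: "p \<in> relations \<Longrightarrow> frag_coord p b = 0"
  by (induction rule: tensor_relations.induct)
    (simp_all add: frag_coord_diff coord_add coord_scale embed_add embed_mult distrib_left distrib_right mult_ac)

text \<open>This is what makes the coordinates separate classes: every tensor is the combination of
  the 1 \<otimes> b with its own coordinates as coefficients. The argument is an induction over the
  free abelian group.\<close>

lemma normal_form_relations: "p - (\<Sum>b\<in>Basis. frag_of (frag_coord p b, b)) \<in> relations"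
proof -
  have "Poly_Mapping.keys p \<subseteq> UNIV"
    by simp
  then show ?thesis
  proof (induction p rule: frag_induction)
    case zero
    have "- frag_of (0 :: 'h, b) \<in> relations" for b
      using tensor_relations.add_left[of "0 :: 'h" 0 b "\<lambda>a h. \<iota> a * h" s] by simp
    then show ?case
      by (simp add: tensor_relations_sum sum_negf[symmetric])
  next
    case (one x)
    obtain \<alpha> z where x: "x = (\<alpha>, z)"
      by force
    \<comment> \<open>Additivity on the right expands z in the basis; balancedness then moves each
      scalar \<open>coord z b\<close> into the left factor.\<close>
    have "(frag_of (\<alpha>, \<Sum>b\<in>Basis. s (coord z b) b) - (\<Sum>b\<in>Basis. frag_of (\<alpha>, s (coord z b) b)))
        + - (\<Sum>b\<in>Basis. frag_of (\<iota> (coord z b) * \<alpha>, b) - frag_of (\<alpha>, s (coord z b) b)) \<in> relations"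
      by (intro tensor_relations_add tensor_relations_uminus tensor_relations_sum
          tensor_relations_sum_right finite_Basis tensor_relations.balanced)
    then show ?case
      by (simp add: x sum_coord sum_subtractf mult.commute)
  next
    case (diff p q)
    \<comment> \<open>\<open>frag_of (x, b)\<close> is not additive in \<open>x\<close>, so the
      normal form of \<open>p - q\<close> differs from the difference of the normal forms by these
      relators.\<close>
    have "frag_of (x, b) - frag_of (x - y, b) - frag_of (y, b) \<in> relations" for x y b
      using tensor_relations.add_left[of "x - y" y b] by simp
    then have *: "(\<Sum>b\<in>Basis. frag_of (frag_coord p b, b)
        - frag_of (frag_coord p b - frag_coord q b, b) - frag_of (frag_coord q b, b)) \<in> relations"
      by (intro tensor_relations_sum)
    show ?case
      using tensor_relations_add[OF tensor_relations.diff[OF diff] *]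
      by (simp add: frag_coord_diff sum_subtractf add_diff_eq)
  qed
qed

text \<open>If all coordinates vanish, \<open>p\<close> has the same normal form as 0 and is
  therefore congruent to 0.\<close>

lemma relations_iff: "p \<in> relations \<longleftrightarrow> (\<forall>b. frag_coord p b = 0)"
proof
  assume p: "\<forall>b. frag_coord p b = 0"
  have "(\<Sum>b\<in>Basis. frag_of (0 :: 'h, b)) \<in> relations"
    using tensor_relations_uminus[OF normal_form_relations[of 0]] by simp
  then show "p \<in> relations"
    using tensor_relations_add[OF normal_form_relations[of p]] p by fastforce
qed (simp add: frag_coord_relations)

lemma ext_rel_eq: "ext_rel \<iota> s = {(p, q). frag_coord p = frag_coord q}"
  by (auto simp: ext_rel_def tensor_rel_def relations_iff frag_coord_diff fun_eq_iff)

section \<open>Classes of formal sums as vectors with coordinates\<close>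

abbreviation cls :: "('h \<times> 'z \<Rightarrow>\<^sub>0 int) \<Rightarrow> ('h, 'z) ext" where
  "cls p \<equiv> ext_rel \<iota> s `` {p}"

lemma ext_carrier_eq: "ext_carrier \<iota> s = range cls"
  by (auto simp: ext_carrier_def quotient_def)

lemma cls_in_carrier [simp]: "cls p \<in> ext_carrier \<iota> s"
  by (simp add: ext_carrier_eq)

lemma mem_cls: "q \<in> cls p \<longleftrightarrow> frag_coord p = frag_coord q"
  by (simp add: ext_rel_eq)

lemma cls_eq_iff: "cls p = cls q \<longleftrightarrow> frag_coord p = frag_coord q"
  by (auto simp: ext_rel_eq)

text \<open>All representatives lead to the same class, so the union in \<open>ext_add\<close> is a
  nonempty union of copies of one set.\<close>

lemma ext_add_cls: "ext_add \<iota> s (cls p) (cls q) = cls (p + q)"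
proof -
  have "cls (p' + q') = cls (p + q)" if "p' \<in> cls p" "q' \<in> cls q" for p' q'
    using that by (simp add: ext_rel_eq fun_eq_iff frag_coord_add)
  moreover have "p \<in> cls p" "q \<in> cls q"
    by (simp_all add: ext_rel_eq)
  ultimately show ?thesis
    unfolding ext_add_def by blast
qed

lemma frag_coord_smult:
  "frag_coord (frag_extend (\<lambda>(\<alpha>, z). frag_of (\<beta> * \<alpha>, z)) p) b = \<beta> * frag_coord p b"
proof -
  have "Poly_Mapping.keys p \<subseteq> UNIV"
    by simp
  then show ?thesis
    by (induction p rule: frag_induction)
      (auto simp: frag_extend_diff frag_coord_diff algebra_simps)
qed

lemma ext_smult_cls:
  "ext_smult \<iota> s \<beta> (cls p) = cls (frag_extend (\<lambda>(\<alpha>, z). frag_of (\<beta> * \<alpha>, z)) p)"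
proof -
  let ?m = "frag_extend (\<lambda>(\<alpha>, z). frag_of (\<beta> * \<alpha>, z))"
  have "cls (?m p') = cls (?m p)" if "p' \<in> cls p" for p'
    using that by (simp add: ext_rel_eq fun_eq_iff frag_coord_smult)
  moreover have "p \<in> cls p"
    by (simp add: ext_rel_eq)
  ultimately show ?thesis
    unfolding ext_smult_def by blast
qed

text \<open>On the carrier the chosen representative does not matter, since all members of a class
  share their coordinates.\<close>

definition ext_coord :: "('h, 'z) ext \<Rightarrow> 'z \<Rightarrow> 'h" where
  "ext_coord A = frag_coord (SOME p. p \<in> A)"

lemma ext_coord_cls [simp]: "ext_coord (cls p) = frag_coord p"
  unfolding ext_coord_def by (metis mem_cls someI)

lemma ext_coord_tensor: "ext_coord (ext_tensor \<iota> s \<alpha> z) b = \<alpha> * \<iota> (coord z b)"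
  by (simp add: ext_tensor_def)

lemma ext_tensor_in_carrier [simp]: "ext_tensor \<iota> s \<alpha> z \<in> ext_carrier \<iota> s"
  by (simp add: ext_tensor_def)

text \<open>The second instance, with the classes 1 \<otimes> b as basis. A coordinate vector
  \<open>v\<close> is attained at the sum of the v b \<otimes> b.\<close>

sublocale ext: coordinate_space \<nu>h "ext_carrier \<iota> s" "ext_add \<iota> s" "ext_smult \<iota> s" Basis ext_coord
proof
  have "inj_on ext_coord (ext_carrier \<iota> s)"
  proof (rule inj_onI)
    fix A A'
    assume "A \<in> ext_carrier \<iota> s" "A' \<in> ext_carrier \<iota> s" and eq: "ext_coord A = ext_coord A'"
    then obtain p p' where "A = cls p" "A' = cls p'"
      unfolding ext_carrier_eq by blast
    with eq show "A = A'"
      by (simp only: ext_coord_cls cls_eq_iff)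
  qed
  moreover have "ext_coord A b = 0" if "A \<in> ext_carrier \<iota> s" "b \<notin> Basis" for A b
  proof -
    obtain p where "A = cls p"
      using \<open>A \<in> ext_carrier \<iota> s\<close> unfolding ext_carrier_eq by blast
    show ?thesis
      unfolding \<open>A = cls p\<close> ext_coord_cls using \<open>b \<notin> Basis\<close> by (rule frag_coord_outside)
  qed
  moreover have "v \<in> ext_coord ` ext_carrier \<iota> s" if v: "\<forall>b. b \<notin> Basis \<longrightarrow> v b = 0" for v
  proof
    show "v = ext_coord (cls (\<Sum>b\<in>Basis. frag_of (v b, b)))"
    proof
      fix c
      have "(\<Sum>b\<in>Basis. v b * \<iota> (coord b c)) = (\<Sum>b\<in>Basis. if b = c then v b else 0)"
        by (intro sum.cong) (auto simp: representation_basis independent_Basis embed_one)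
      also have "\<dots> = v c"
        using v by (simp add: finite_Basis)
      finally show "v c = ext_coord (cls (\<Sum>b\<in>Basis. frag_of (v b, b))) c"
        by (simp only: ext_coord_cls frag_coord_sum frag_coord_of)
    qed
  qed simp
  ultimately show "bij_betw ext_coord (ext_carrier \<iota> s) {v. \<forall>b. b \<notin> Basis \<longrightarrow> v b = 0}"
    unfolding bij_betw_def by blast
qed (auto simp: ext_carrier_eq finite_Basis ext_add_cls ext_smult_cls frag_coord_add frag_coord_smult)

section \<open>The subspace attached to a compatible topology\<close>

abbreviation emb :: "'z \<Rightarrow> ('h, 'z) ext" where
  "emb \<equiv> ext_tensor \<iota> s 1"

abbreviation eadd :: "('h, 'z) ext \<Rightarrow> ('h, 'z) ext \<Rightarrow> ('h, 'z) ext" where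
  "eadd \<equiv> ext_add \<iota> s"

abbreviation esc :: "'h \<Rightarrow> ('h, 'z) ext \<Rightarrow> ('h, 'z) ext" where
  "esc \<equiv> ext_smult \<iota> s"

lemma emb_add: "emb (x + y) = eadd (emb x) (emb y)"
  by (rule ext.coord_eqI)
    (simp_all add: ext.pl_closed ext.coord_pl ext_coord_tensor coord_add embed_add)

lemma emb_scale: "emb (s a x) = esc (\<iota> a) (emb x)"
  by (rule ext.coord_eqI)
    (simp_all add: ext.sc_closed ext.coord_sc ext_coord_tensor coord_scale embed_mult)

text \<open>Both metrics are formed with the same basis, and \<iota> is isometric.\<close>

lemma cdist_emb: "ext.cdist (emb x) (emb y) = scl.cdist x y"
  by (simp add: ext.cdist_def scl.cdist_def ext_coord_tensor embed_val flip: embed_diff)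

text \<open>The largest compatible topology is that of the metric, so closure becomes approximation.
  The hypothesis supplies a set \<open>U\<close>, which places the elements of \<open>F_hat\<close>
  in the carrier.\<close>

lemma F_hat_iff:
  assumes "openin T UNIV"
  shows "A \<in> F_hat \<nu>h \<iota> s T \<longleftrightarrow> A \<in> ext_carrier \<iota> s \<and>
    (\<forall>U. openin T U \<and> 0 \<in> U \<longrightarrow> (\<forall>\<epsilon>>0. \<exists>u\<in>U. ext.cdist A (emb u) < \<epsilon>))"
  using assms
  by (auto simp: F_hat_def ext_max_topology_def ext.max_compatible_topology_eq ext.crd.metric_closure_of)

lemma emb_zero_in_F_hat:
  assumes "openin T UNIV"
  shows "emb 0 \<in> F_hat \<nu>h \<iota> s T"
proof -
  have "ext.cdist (emb 0) (emb 0) = 0"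
    by simp
  then show ?thesis
    unfolding F_hat_iff[OF assms] by (metis ext_tensor_in_carrier)
qed

section \<open>Neighbourhoods of 0 and stability of \<open>F_hat\<close>\<close>

lemma compatible_UNIV_open:
  "T \<in> compatible_topologies (val_topology \<nu>) UNIV (+) s \<Longrightarrow> openin T UNIV"
  using base.compatible_topspace openin_topspace by metis

lemma nhd_add:
  assumes "T \<in> compatible_topologies (val_topology \<nu>) UNIV (+) s" "openin T U" "0 \<in> U"
  obtains V where "openin T V" "0 \<in> V" "\<forall>v\<in>V. \<forall>w\<in>V. v + w \<in> U"
proof -
  obtain V W where "openin T V" "0 \<in> V" "openin T W" "0 \<in> W" "\<forall>v\<in>V. \<forall>w\<in>W. v + w \<in> U"
    by (rule base.compatible_add_nhds[OF assms(1,2), of 0 0]) (use assms in auto)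
  then show ?thesis
    by (intro that[of "V \<inter> W"]) auto
qed

text \<open>A replacement for balanced neighbourhoods, restricted to powers of \<open>t\<close>. All
  powers from \<open>t ^ m\<close> on send \<open>W\<close> into \<open>U\<close>; passing to the
  image of \<open>W\<close> under \<open>t ^ m\<close> shifts the exponents, so that every
  \<open>n\<close> is covered.\<close>

lemma nhd_powers:
  assumes T: "T \<in> compatible_topologies (val_topology \<nu>) UNIV (+) s"
    and t: "0 < \<nu> t" "\<nu> t < 1" and U: "openin T U" "0 \<in> U"
  obtains V where "openin T V" "0 \<in> V" "\<forall>v\<in>V. \<forall>n. s (t ^ n) v \<in> U"
proof -
  have "t \<noteq> 0"
    using t by auto
  have z: "s 0 0 \<in> U"
    using U by simp
  obtain \<delta> W where \<delta>: "\<delta> > 0" "openin T W" "0 \<in> W" "\<forall>c. \<forall>y\<in>W. \<nu> (c - 0) < \<delta> \<longrightarrow> s c y \<in> U"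
    by (rule base.compatible_scale_nhds[OF T U(1) UNIV_I z])
  obtain m where m: "\<nu> t ^ m < \<delta>"
    using real_arch_pow_inv[OF \<delta>(1) t(2)] by blast
  let ?V = "{x \<in> UNIV. s (inverse (t ^ m)) x \<in> W}"
  have "s (t ^ n) v \<in> U" if "v \<in> ?V" for v n
  proof -
    have "\<nu> t ^ n * \<nu> t ^ m \<le> 1 * \<nu> t ^ m"
      using t by (intro mult_right_mono power_le_one) auto
    then have "\<nu> (t ^ n * t ^ m - 0) < \<delta>"
      using m by (simp add: base.mult base.val_power)
    then have "s (t ^ n * t ^ m) (s (inverse (t ^ m)) v) \<in> U"
      using \<delta>(4) that by blast
    then show ?thesis
      using \<open>t \<noteq> 0\<close> by (simp add: mult.assoc)
  qed
  moreover have "openin T ?V"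
    by (rule base.compatible_scale_preimage[OF T \<delta>(2)])
  ultimately show ?thesis
    using \<delta>(3) by (intro that[of ?V]) auto
qed

text \<open>Preimages of neighbourhoods of 0 under the scalar \<open>c\<close> are neighbourhoods of
  0, and \<open>c\<close> scales distances by \<nu> c. Scalars from \<open>K\<close> suffice for the
  rescaling in \<open>emb_near_F_hat\<close>.\<close>

lemma F_hat_scale:
  assumes T: "T \<in> compatible_topologies (val_topology \<nu>) UNIV (+) s"
    and A: "A \<in> F_hat \<nu>h \<iota> s T" and "c \<noteq> 0"
  shows "esc (\<iota> c) A \<in> F_hat \<nu>h \<iota> s T"
proof -
  note F_hat = F_hat_iff[OF compatible_UNIV_open[OF T]]
  have AE: "A \<in> ext_carrier \<iota> s"
    using A F_hat by blast
  have "\<exists>u\<in>U. ext.cdist (esc (\<iota> c) A) (emb u) < \<epsilon>" if U: "openin T U" "0 \<in> U" and "\<epsilon> > 0" for U \<epsilon>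
  proof -
    let ?V = "{x \<in> UNIV. s c x \<in> U}"
    have "openin T ?V" "0 \<in> ?V"
      using base.compatible_scale_preimage[OF T U(1)] U(2) by auto
    moreover have "\<epsilon> / \<nu> c > 0"
      using \<open>\<epsilon> > 0\<close> base.val_pos[OF \<open>c \<noteq> 0\<close>] by simp
    ultimately obtain v where "v \<in> ?V" "ext.cdist A (emb v) < \<epsilon> / \<nu> c"
      using A F_hat by blast
    moreover have "ext.cdist (esc (\<iota> c) A) (emb (s c v)) = \<nu> c * ext.cdist A (emb v)"
      by (simp add: emb_scale ext.cdist_sc AE embed_val)
    ultimately show ?thesis
      using base.val_pos[OF \<open>c \<noteq> 0\<close>] by (intro bexI[of _ "s c v"]) (auto simp: field_simps)
  qed
  then show ?thesis
    unfolding F_hat using AE by (simp add: ext.sc_closed)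
qed

text \<open>Both summands are approximated from a neighbourhood V with V + V \<subseteq> U.\<close>

lemma F_hat_add:
  assumes T: "T \<in> compatible_topologies (val_topology \<nu>) UNIV (+) s"
    and A: "A \<in> F_hat \<nu>h \<iota> s T" and A': "A' \<in> F_hat \<nu>h \<iota> s T"
  shows "eadd A A' \<in> F_hat \<nu>h \<iota> s T"
proof -
  note F_hat = F_hat_iff[OF compatible_UNIV_open[OF T]]
  have E: "A \<in> ext_carrier \<iota> s" "A' \<in> ext_carrier \<iota> s"
    using A A' F_hat by blast+
  have "\<exists>u\<in>U. ext.cdist (eadd A A') (emb u) < \<epsilon>" if U: "openin T U" "0 \<in> U" and "\<epsilon> > 0" for U \<epsilon>
  proof -
    obtain V where V: "openin T V" "0 \<in> V" "\<forall>v\<in>V. \<forall>w\<in>V. v + w \<in> U"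
      by (rule nhd_add[OF T U])
    have "\<epsilon> / 2 > 0"
      using \<open>\<epsilon> > 0\<close> by simp
    then obtain v w where "v \<in> V" "w \<in> V" "ext.cdist A (emb v) < \<epsilon> / 2" "ext.cdist A' (emb w) < \<epsilon> / 2"
      using A A' V(1,2) F_hat by metis
    moreover have "ext.cdist (eadd A A') (emb (v + w)) \<le> ext.cdist A (emb v) + ext.cdist A' (emb w)"
      unfolding emb_add by (intro ext.cdist_pl E) simp_all
    ultimately show ?thesis
      using V(3) by (intro bexI[of _ "v + w"]) auto
  qed
  then show ?thesis
    unfolding F_hat using E by (simp add: ext.pl_closed)
qed

text \<open>A point of \<open>U\<close> far from \<open>F_hat\<close> can be rescaled and translated along \<open>F_hat\<close> into a fixed
  ball, which is compact; a cluster point of the results lies in \<open>F_hat\<close> and yet far from it.\<close>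

lemma emb_near_F_hat:
  assumes T: "T \<in> compatible_topologies (val_topology \<nu>) UNIV (+) s"
    and lc: "locally_compact_space (val_topology \<nu>h)"
    and t: "0 < \<nu> t" "\<nu> t < 1"
    and \<epsilon>: "\<epsilon> > 0"
  shows "\<exists>U. openin T U \<and> 0 \<in> U \<and> (\<forall>u\<in>U. \<exists>A\<in>F_hat \<nu>h \<iota> s T. ext.cdist (emb u) A < \<epsilon>)"
proof (rule ccontr)
  note F_hat = F_hat_iff[OF compatible_UNIV_open[OF T]]
  define G where "G = F_hat \<nu>h \<iota> s T"
  assume "\<not> ?thesis"
  then have far: "\<exists>u\<in>U. \<forall>A\<in>G. ext.cdist (emb u) A \<ge> \<epsilon>" if "openin T U" "0 \<in> U" for U
    using that unfolding G_def by (meson not_less)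
  have GE: "A \<in> ext_carrier \<iota> s" if "A \<in> G" for A
    using that F_hat unfolding G_def by blast
  have t0: "t \<noteq> 0"
    using t by auto
  \<comment> \<open>Division by \<open>t\<close> turns a distance below \<epsilon> into one below
    \<open>R\<close>.\<close>
  define R where "R = \<epsilon> / \<nu> t"
  \<comment> \<open>The points of the closure for \<open>U\<close> at distance at least \<epsilon>
    from \<open>F_hat\<close>. A point common to all these closed sets will give the
    contradiction.\<close>
  define Q where "Q U = (ext.crd.mtopology closure_of (emb ` U)) \<inter>
    (ext_carrier \<iota> s - (\<Union>A\<in>G. ext.crd.mball A \<epsilon>))" for U
  have Q_closed: "closedin ext.crd.mtopology (Q U)" for U
    unfolding Q_def
    by (intro closedin_Int closedin_closure_of closedin_diff openin_Union)
      (auto intro: ext.crd.closedin_mspace)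
  have Q_meets: "ext.crd.mcball (emb 0) R \<inter> Q U \<noteq> {}" if U: "openin T U" "0 \<in> U" for U
  proof -
    \<comment> \<open>\<open>V\<close> leaves room for a translation along \<open>F_hat\<close>, and
      \<open>W\<close> for multiplication by any power of \<open>t\<close>.\<close>
    obtain V where V: "openin T V" "0 \<in> V" "\<forall>v\<in>V. \<forall>w\<in>V. v + w \<in> U"
      by (rule nhd_add[OF T U])
    obtain W where W: "openin T W" "0 \<in> W" "\<forall>w\<in>W. \<forall>n. s (t ^ n) w \<in> V"
      by (rule nhd_powers[OF T t V(1,2)])
    obtain u where u: "u \<in> W" "\<forall>A\<in>G. ext.cdist (emb u) A \<ge> \<epsilon>"
      using far[OF W(1,2)] by blast
    \<comment> \<open>The vectors t ^ n u tend to 0, and \<open>emb 0\<close> lies in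
      \<open>F_hat\<close>, so \<open>near\<close> holds for some n but not for n = 0. A passage
      from far to near yields v = t ^ n u far from \<open>F_hat\<close> with t v near it.\<close>
    define near where "near n \<longleftrightarrow> (\<exists>A\<in>G. ext.cdist (emb (s (t ^ n) u)) A < \<epsilon>)" for n
    have "\<exists>n. near n"
    proof -
      have "(\<lambda>n. \<nu> t ^ n * scl.cdist u 0) \<longlonglongrightarrow> 0 * scl.cdist u 0"
        by (intro tendsto_mult tendsto_const LIMSEQ_realpow_zero) (use t in auto)
      then have "\<forall>\<^sub>F n in sequentially. \<nu> t ^ n * scl.cdist u 0 < \<epsilon>"
        using \<epsilon> by (intro order_tendstoD(2)) auto
      then obtain n where "\<nu> t ^ n * scl.cdist u 0 < \<epsilon>"
        by (auto simp: eventually_sequentially)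
      moreover have "scl.cdist (s (t ^ n) u) 0 = \<nu> t ^ n * scl.cdist u 0"
        using scl.cdist_sc[of u 0 "t ^ n"] by (simp add: base.val_power)
      ultimately have "ext.cdist (emb (s (t ^ n) u)) (emb 0) < \<epsilon>"
        by (simp add: cdist_emb)
      then show ?thesis
        unfolding near_def G_def using emb_zero_in_F_hat[OF compatible_UNIV_open[OF T]] by blast
    qed
    moreover have "\<not> near 0"
      using u by (auto simp: near_def not_less)
    ultimately obtain n where n: "near (Suc n)" "\<not> near n"
      by (metis (no_types) not0_implies_Suc exists_least_iff lessI)
    define v where "v = s (t ^ n) u"
    have v: "v \<in> V" "\<And>A. A \<in> G \<Longrightarrow> ext.cdist (emb v) A \<ge> \<epsilon>"
      using u W n(2) by (auto simp: v_def near_def not_less)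
    obtain A where A: "A \<in> G" "ext.cdist (emb (s t v)) A < \<epsilon>"
      using n(1) by (auto simp: near_def v_def scale_scale)
    define a where "a = inverse t"
    define A' where "A' = esc (\<iota> (- a)) A"
    have a: "a \<noteq> 0" "\<nu> a = inverse (\<nu> t)" "s a (s t x) = x" for x
      using t0 by (auto simp: a_def base.val_inverse)
    have A': "A' \<in> G"
      using F_hat_scale[OF T, of A "- a"] A a by (simp add: A'_def G_def)
    \<comment> \<open>With a = 1 / t this is v - a A = a (t v - A): a translate of v along
      \<open>F_hat\<close> that has size at most \<open>R\<close>, because A is close to t
      v.\<close>
    define C where "C = eadd (emb v) A'"
    have CE: "C \<in> ext_carrier \<iota> s"
      using A' GE by (simp add: C_def ext.pl_closed)
    have dist_C: "ext.cdist C D = ext.cdist (emb v) (eadd D (esc (\<iota> a) A))" if "D \<in> ext_carrier \<iota> s" for D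
      using ext.cdist_pl_sc[of "emb v" A D "\<iota> a"] that GE[OF A(1)]
      by (simp add: C_def A'_def embed_minus)
    have "ext.cdist C (emb 0) \<le> R"
    proof -
      have "eadd (emb 0) (esc (\<iota> a) A) = esc (\<iota> a) A"
        using GE[OF A(1)]
        by (intro ext.coord_eqI)
          (simp_all add: ext.pl_closed ext.sc_closed ext.coord_pl ext_coord_tensor representation_zero)
      then have "ext.cdist C (emb 0) = ext.cdist (emb (s a (s t v))) (esc (\<iota> a) A)"
        by (simp only: dist_C a(3) ext_tensor_in_carrier)
      also have "\<dots> = \<nu> a * ext.cdist (emb (s t v)) A"
        unfolding emb_scale[of a] using GE[OF A(1)] by (simp add: ext.cdist_sc embed_val)
      also have "\<dots> \<le> R"
        using A(2) t by (simp add: R_def a field_simps)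
      finally show ?thesis .
    qed
    \<comment> \<open>Approximating \<open>A'\<close> by \<open>emb w\<close> with w in V
      approximates \<open>C\<close> by \<open>emb (v + w)\<close>, and v + w lies in
      \<open>U\<close>.\<close>
    moreover have "C \<in> ext.crd.mtopology closure_of (emb ` U)"
      unfolding ext.crd.metric_closure_of
    proof (intro CollectI conjI CE allI impI)
      fix r :: real
      assume "r > 0"
      then obtain w where w: "w \<in> V" "ext.cdist A' (emb w) < r"
        using A' V(1,2) F_hat unfolding G_def by blast
      have "ext.cdist C (emb (v + w)) \<le> ext.cdist (emb v) (emb v) + ext.cdist A' (emb w)"
        unfolding C_def emb_add using GE[OF A'] by (intro ext.cdist_pl) auto
      also have "\<dots> < r"
        using w by simp
      finally show "\<exists>y\<in>emb ` U. y \<in> ext.crd.mball C r"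
        using V(3) v(1) w(1) CE by fastforce
    qed
    \<comment> \<open>\<open>F_hat\<close> is stable under translation by a A, so \<open>C\<close>
      inherits from v the distance of at least \<epsilon>.\<close>
    moreover have "ext.cdist D C \<ge> \<epsilon>" if "D \<in> G" for D
    proof -
      have "eadd D (esc (\<iota> a) A) \<in> G"
        using F_hat_add[OF T] F_hat_scale[OF T _ a(1)] A(1) that by (simp add: G_def)
      then show ?thesis
        using v(2) dist_C[OF GE[OF that]] ext.crd.commute[of D C] by simp
    qed
    ultimately have "C \<in> ext.crd.mcball (emb 0) R \<inter> Q U"
      using CE by (force simp: Q_def ext.crd.commute[of "emb 0" C])
    then show ?thesis
      by blast
  qed
  let ?\<U> = "Q ` {U. openin T U \<and> 0 \<in> U}"
  have fip: "ext.crd.mcball (emb 0) R \<inter> \<Inter> \<F> \<noteq> {}" if fin: "finite \<F>" "\<F> \<subseteq> ?\<U>" for \<F>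
  proof -
    obtain \<V> where \<V>: "finite \<V>" "\<V> \<subseteq> {U. openin T U \<and> 0 \<in> U}" "\<F> = Q ` \<V>"
      using finite_subset_image[OF fin] by blast
    \<comment> \<open>Inserting \<open>UNIV\<close> covers the empty subfamily.\<close>
    let ?W = "\<Inter> (insert UNIV \<V>)"
    have "openin T ?W"
      by (rule openin_Inter) (use \<V> compatible_UNIV_open[OF T] in auto)
    moreover have "0 \<in> ?W"
      using \<V> by auto
    ultimately have "ext.crd.mcball (emb 0) R \<inter> Q ?W \<noteq> {}"
      by (rule Q_meets)
    moreover have "Q ?W \<subseteq> \<Inter> \<F>"
      unfolding \<V>(3) Q_def using closure_of_mono[of "emb ` ?W" "emb ` _"] by (fastforce intro: image_mono)
    ultimately show ?thesis
      by blast
  qed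
  have compact: "compactin ext.crd.mtopology (ext.crd.mcball (emb 0) R)"
    using t by (intro ext.compactin_mcball[OF lc, of "\<iota> t"]) (simp_all add: embed_val)
  have "ext.crd.mcball (emb 0) R \<inter> \<Inter> ?\<U> \<noteq> {}"
    by (rule conjunct2[OF compactin_fip[THEN iffD1, OF compact], THEN spec, THEN mp])
      (use Q_closed fip in blast)
  \<comment> \<open>Lying in every closure, \<open>C\<close> belongs to \<open>F_hat\<close>; yet
    its distance from every element of \<open>F_hat\<close>, itself included, is at least
    \<epsilon>.\<close>
  then obtain C where C: "C \<in> Q U" if "openin T U" "0 \<in> U" for U
    by blast
  have "C \<in> ext.crd.mtopology closure_of (emb ` U)" if "openin T U" "0 \<in> U" for U
    using C[OF that] unfolding Q_def by blast
  then have "C \<in> G"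
    unfolding G_def F_hat_def ext_max_topology_def ext.max_compatible_topology_eq by blast
  moreover have "C \<notin> G"
  proof
    assume "C \<in> G"
    then have "C \<in> ext.crd.mball C \<epsilon>"
      using \<epsilon> GE by simp
    then show False
      using C[of UNIV] compatible_UNIV_open[OF T] \<open>C \<in> G\<close> unfolding Q_def by blast
  qed
  ultimately show False
    by blast
qed

text \<open>A point A of \<open>F_hat\<close> is close to some \<open>emb v\<close> with v in V. If
  z is close to A, then z - v is small in the metric and lies in V, since T is coarser than the
  metric topology; hence z = (z - v) + v lies in U.\<close>

lemma nhd_contains_near_F_hat:
  assumes T: "T \<in> compatible_topologies (val_topology \<nu>) UNIV (+) s"
    and U: "openin T U" "0 \<in> U"
  obtains \<epsilon> where "\<epsilon> > 0" "\<forall>z. \<forall>A\<in>F_hat \<nu>h \<iota> s T. ext.cdist (emb z) A < \<epsilon> \<longrightarrow> z \<in> U"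
proof -
  note F_hat = F_hat_iff[OF compatible_UNIV_open[OF T]]
  obtain V where V: "openin T V" "0 \<in> V" "\<forall>v\<in>V. \<forall>w\<in>V. v + w \<in> U"
    by (rule nhd_add[OF T U])
  obtain \<epsilon> where \<epsilon>: "\<epsilon> > 0" "scl.crd.mball 0 \<epsilon> \<subseteq> V"
    by (rule scl.compatible_open_contains_ball[OF T V(1,2)])
  have "z \<in> U" if A: "A \<in> F_hat \<nu>h \<iota> s T" and z: "ext.cdist (emb z) A < \<epsilon> / 2" for z A
  proof -
    have "\<epsilon> / 2 > 0"
      using \<epsilon> by simp
    then obtain v where v: "v \<in> V" "ext.cdist A (emb v) < \<epsilon> / 2"
      using A V(1,2) F_hat by blast
    have "scl.cdist 0 (z - v) = scl.cdist z v"
      using coord_add[of "z - v" v]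
      by (simp add: scl.cdist_def representation_zero base.val_minus_commute)
    also have "\<dots> = ext.cdist (emb z) (emb v)"
      by (simp add: cdist_emb)
    also have "\<dots> < \<epsilon>"
      using ext.cdist_triangle[of "emb z" "emb v" A] z v by simp
    finally have "z - v \<in> V"
      using \<epsilon>(2) by auto
    then show ?thesis
      using V(3) v(1) by fastforce
  qed
  with \<epsilon>(1) show ?thesis
    by (intro that[of "\<epsilon> / 2"]) auto
qed

end

text \<open>Neighbourhoods of x and of f x are compared with those of 0 by translations, whose
  continuity comes from that of addition.\<close>

lemma continuous_map_additive_iff:
  fixes f :: "'x::ab_group_add \<Rightarrow> 'y::ab_group_add"
  assumes "valuation_field \<nu>"
    and T: "T \<in> compatible_topologies (val_topology \<nu>) UNIV (+) sX"
    and T': "T' \<in> compatible_topologies (val_topology \<nu>) UNIV (+) sY"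
    and f: "\<And>x y. f (x + y) = f x + f y"
  shows "continuous_map T T' f \<longleftrightarrow>
    (\<forall>V. openin T' V \<and> 0 \<in> V \<longrightarrow> (\<exists>U. openin T U \<and> 0 \<in> U \<and> f ` U \<subseteq> V))"
proof -
  interpret valuation_field \<nu> by fact
  have top: "topspace T = UNIV" "topspace T' = UNIV"
    using compatible_topspace T T' by metis+
  have f0: "f 0 = 0"
    using f[of 0 0] by simp
  show ?thesis
  proof safe
    fix V
    assume "continuous_map T T' f" and V: "openin T' V" "0 \<in> V"
    then have "openin T {x \<in> topspace T. f x \<in> V}"
      using openin_continuous_map_preimage by blast
    then show "\<exists>U. openin T U \<and> 0 \<in> U \<and> f ` U \<subseteq> V"
      using V f0 top by (intro exI[of _ "{x \<in> topspace T. f x \<in> V}"]) auto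
  next
    assume cont: "\<forall>V. openin T' V \<and> 0 \<in> V \<longrightarrow> (\<exists>U. openin T U \<and> 0 \<in> U \<and> f ` U \<subseteq> V)"
    have "\<exists>U. openin T U \<and> x \<in> U \<and> U \<subseteq> {x. f x \<in> V}" if V: "openin T' V" "f x \<in> V" for V x
    proof -
      have "f x + 0 \<in> V"
        using V by simp
      then obtain W W' where W: "f x \<in> W" "openin T' W'" "0 \<in> W'" "\<forall>v\<in>W. \<forall>w\<in>W'. v + w \<in> V"
        by (rule compatible_add_nhds[OF T' V(1) UNIV_I UNIV_I])
      obtain U where U: "openin T U" "0 \<in> U" "f ` U \<subseteq> W'"
        using cont W(2,3) by blast
      \<comment> \<open>This yields a neighbourhood \<open>A'\<close> of x whose translate by - x
        lies in \<open>U\<close>.\<close>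
      have "- x + x \<in> U"
        using U by simp
      then obtain A A' where A: "openin T A'" "- x \<in> A" "x \<in> A'" "\<forall>v\<in>A. \<forall>w\<in>A'. v + w \<in> U"
        by (rule compatible_add_nhds[OF T U(1) UNIV_I UNIV_I])
      have "f y \<in> V" if "y \<in> A'" for y
      proof -
        have "- x + y \<in> U"
          using A that by blast
        then have "f x + f (- x + y) \<in> V"
          using U(3) W by blast
        then show ?thesis
          by (simp flip: f)
      qed
      then show ?thesis
        using A by blast
    qed
    then show "continuous_map T T' f"
      unfolding continuous_map_def top using openin_subopen[of T "{x. f x \<in> _}"] by auto
  qed
qed

section \<open>The extended linear map\<close>

locale scalar_extension_linear =
  X: scalar_extension \<nu> \<nu>h \<iota> sX BX + Y: scalar_extension \<nu> \<nu>h \<iota> sY BY +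
  L: Vector_Spaces.linear sX sY L
  for \<nu> :: "'k::field \<Rightarrow> real" and \<nu>h :: "'h::field \<Rightarrow> real" and \<iota> :: "'k \<Rightarrow> 'h"
    and sX :: "'k \<Rightarrow> 'x::ab_group_add \<Rightarrow> 'x" and BX
    and sY :: "'k \<Rightarrow> 'y::ab_group_add \<Rightarrow> 'y" and BY
    and L :: "'x \<Rightarrow> 'y" +
  fixes Lh :: "('h, 'x) ext \<Rightarrow> ('h, 'y) ext"
  assumes Lh_linear: "ext_linear \<iota> sX sY Lh"
    and Lh_tensor: "Lh (ext_tensor \<iota> sX \<alpha> x) = ext_tensor \<iota> sY \<alpha> (L x)"
begin

section \<open>The matrix of the extended map and its boundedness\<close>

lemma Lh_carrier: "A \<in> ext_carrier \<iota> sX \<Longrightarrow> Lh A \<in> ext_carrier \<iota> sY"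
  using Lh_linear by (auto simp: ext_linear_def)

lemma Lh_add:
  "A \<in> ext_carrier \<iota> sX \<Longrightarrow> A' \<in> ext_carrier \<iota> sX \<Longrightarrow> Lh (X.eadd A A') = Y.eadd (Lh A) (Lh A')"
  using Lh_linear by (auto simp: ext_linear_def)

lemma coord_L: "Y.coord (L x) c = (\<Sum>b\<in>BX. X.coord x b * Y.coord (L b) c)"
proof -
  have "L x = L (\<Sum>b\<in>BX. sX (X.coord x b) b)"
    by (simp add: X.sum_coord)
  also have "\<dots> = (\<Sum>b\<in>BX. sY (X.coord x b) (L b))"
    by (simp add: L.sum L.scale)
  finally show ?thesis
    by (simp add: Y.representation_sum Y.independent_Basis Y.span_Basis Y.coord_scale)
qed

text \<open>\<open>Lh\<close> has the matrix of \<open>L\<close>, transported by \<iota>. Both sides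
  are additive in \<open>p\<close>, so a comparison on pure tensors suffices, where
  \<open>Lh_tensor\<close> prescribes the values.\<close>

lemma ext_coord_Lh_cls:
  "Y.ext_coord (Lh (X.cls p)) c = (\<Sum>b\<in>BX. X.frag_coord p b * \<iota> (Y.coord (L b) c))"
proof -
  have tensor: "X.cls (frag_of (\<alpha>, x)) = ext_tensor \<iota> sX \<alpha> x" for \<alpha> x
    by (simp only: ext_tensor_def)
  have "Poly_Mapping.keys p \<subseteq> UNIV"
    by simp
  then show ?thesis
  proof (induction p rule: frag_induction)
    case zero
    \<comment> \<open>The zero class is presented as a pure tensor so that \<open>Lh_tensor\<close>
      applies.\<close>
    have "X.cls 0 = ext_tensor \<iota> sX 0 0"
      unfolding tensor[symmetric] X.cls_eq_iff by (simp add: fun_eq_iff)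
    then have "Lh (X.cls 0) = ext_tensor \<iota> sY 0 (L 0)"
      by (simp only: Lh_tensor)
    then show ?case
      by (simp only: Y.ext_coord_tensor X.frag_coord_zero) simp
  next
    case (one x)
    obtain \<alpha> z where x: "x = (\<alpha>, z)"
      by force
    have "Lh (X.cls (frag_of x)) = ext_tensor \<iota> sY \<alpha> (L z)"
      by (simp only: x tensor Lh_tensor)
    then have "Y.ext_coord (Lh (X.cls (frag_of x))) c = \<alpha> * \<iota> (Y.coord (L z) c)"
      by (simp only: Y.ext_coord_tensor)
    then show ?case
      by (simp only: x X.frag_coord_of coord_L[of z] X.embed_sum X.embed_mult sum_distrib_left mult.assoc)
  next
    case (diff p q)
    \<comment> \<open>\<open>Lh_add\<close> speaks of sums, so the difference is treated through p =
      (p - q) + q.\<close>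
    have "Lh (X.cls p) = Lh (X.eadd (X.cls (p - q)) (X.cls q))"
      by (simp only: X.ext_add_cls diff_add_cancel)
    also have "\<dots> = Y.eadd (Lh (X.cls (p - q))) (Lh (X.cls q))"
      by (intro Lh_add X.cls_in_carrier)
    finally have "Y.ext_coord (Lh (X.cls p)) c
        = Y.ext_coord (Lh (X.cls (p - q))) c + Y.ext_coord (Lh (X.cls q)) c"
      by (simp only: Y.ext.coord_pl Lh_carrier X.cls_in_carrier)
    then have "Y.ext_coord (Lh (X.cls (p - q))) c
        = Y.ext_coord (Lh (X.cls p)) c - Y.ext_coord (Lh (X.cls q)) c"
      by (simp only: eq_diff_eq)
    then show ?case
      by (simp only: diff X.frag_coord_diff left_diff_distrib sum_subtractf)
  qed
qed

lemma ext_coord_Lh: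
  assumes "A \<in> ext_carrier \<iota> sX"
  shows "Y.ext_coord (Lh A) c = (\<Sum>b\<in>BX. X.ext_coord A b * \<iota> (Y.coord (L b) c))"
proof -
  obtain p where "A = X.cls p"
    using assms unfolding X.ext_carrier_eq by blast
  then show ?thesis
    by (simp only: ext_coord_Lh_cls X.ext_coord_cls)
qed

text \<open>The sum of the valuations of all matrix entries is a Lipschitz constant.\<close>

lemma Lh_bounded:
  obtains C where "C > 0"
    "\<forall>A\<in>ext_carrier \<iota> sX. \<forall>A'\<in>ext_carrier \<iota> sX. Y.ext.cdist (Lh A) (Lh A') \<le> C * X.ext.cdist A A'"
proof -
  define C where "C = (\<Sum>c\<in>BY. \<Sum>b\<in>BX. \<nu> (Y.coord (L b) c))"
  have C: "C \<ge> 0"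
    by (simp add: C_def sum_nonneg X.base.nonneg)
  have "Y.ext.cdist (Lh A) (Lh A') \<le> C * X.ext.cdist A A'"
    if A: "A \<in> ext_carrier \<iota> sX" "A' \<in> ext_carrier \<iota> sX" for A A'
  proof -
    have "\<nu>h (Y.ext_coord (Lh A) c - Y.ext_coord (Lh A') c)
        \<le> (\<Sum>b\<in>BX. X.ext.cdist A A' * \<nu> (Y.coord (L b) c))" for c
    proof -
      have "Y.ext_coord (Lh A) c - Y.ext_coord (Lh A') c
          = (\<Sum>b\<in>BX. (X.ext_coord A b - X.ext_coord A' b) * \<iota> (Y.coord (L b) c))"
        by (simp add: ext_coord_Lh A left_diff_distrib sum_subtractf)
      also have "\<nu>h \<dots> \<le> (\<Sum>b\<in>BX. \<nu>h ((X.ext_coord A b - X.ext_coord A' b) * \<iota> (Y.coord (L b) c)))"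
        by (rule X.compl.val_sum_le)
      also have "\<dots> \<le> (\<Sum>b\<in>BX. X.ext.cdist A A' * \<nu> (Y.coord (L b) c))"
        unfolding X.compl.mult X.embed_val
        by (intro sum_mono mult_right_mono X.ext.val_coord_le_cdist X.base.nonneg)
      finally show ?thesis .
    qed
    then have "Y.ext.cdist (Lh A) (Lh A') \<le> (\<Sum>c\<in>BY. \<Sum>b\<in>BX. X.ext.cdist A A' * \<nu> (Y.coord (L b) c))"
      unfolding Y.ext.cdist_def by (intro sum_mono)
    also have "\<dots> = C * X.ext.cdist A A'"
      by (simp add: C_def sum_distrib_left mult.commute)
    finally show ?thesis .
  qed
  \<comment> \<open>Adding 1 makes the constant positive even when every entry is 0;
    \<open>Lh_continuous\<close> divides by it.\<close>
  then have "\<forall>A\<in>ext_carrier \<iota> sX. \<forall>A'\<in>ext_carrier \<iota> sX.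
      Y.ext.cdist (Lh A) (Lh A') \<le> (C + 1) * X.ext.cdist A A'"
    by (smt (verit, best) X.ext.crd.nonneg mult_right_mono)
  with C show ?thesis
    by (intro that[of "C + 1"]) auto
qed

lemma Lh_continuous:
  assumes "\<epsilon> > 0"
  obtains \<delta> where "\<delta> > 0" "\<forall>A\<in>ext_carrier \<iota> sX. \<forall>A'\<in>ext_carrier \<iota> sX.
    X.ext.cdist A A' < \<delta> \<longrightarrow> Y.ext.cdist (Lh A) (Lh A') < \<epsilon>"
proof -
  obtain C where C: "C > 0"
    "\<forall>A\<in>ext_carrier \<iota> sX. \<forall>A'\<in>ext_carrier \<iota> sX. Y.ext.cdist (Lh A) (Lh A') \<le> C * X.ext.cdist A A'"
    by (rule Lh_bounded)
  have "C * X.ext.cdist A A' < \<epsilon>" if "X.ext.cdist A A' < \<epsilon> / C" for A A'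
    using that C(1) by (simp add: field_simps)
  then have "\<forall>A\<in>ext_carrier \<iota> sX. \<forall>A'\<in>ext_carrier \<iota> sX.
      X.ext.cdist A A' < \<epsilon> / C \<longrightarrow> Y.ext.cdist (Lh A) (Lh A') < \<epsilon>"
    using C(2) le_less_trans by blast
  with C assms show ?thesis
    by (intro that[of "\<epsilon> / C"]) simp_all
qed

lemma Lh_emb: "Lh (X.emb x) = Y.emb (L x)"
  by (rule Lh_tensor)

text \<open>With L(U) \<subseteq> V, approximants \<open>emb u\<close> of A with u in U are sent to
  approximants \<open>emb (L u)\<close> of \<open>Lh A\<close> with L u in V.\<close>

lemma continuous_imp_Lh_F_hat:
  assumes TX: "TX \<in> compatible_topologies (val_topology \<nu>) UNIV (+) sX"
    and TY: "TY \<in> compatible_topologies (val_topology \<nu>) UNIV (+) sY"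
    and cont: "continuous_map TX TY L"
  shows "Lh ` F_hat \<nu>h \<iota> sX TX \<subseteq> F_hat \<nu>h \<iota> sY TY"
proof
  note F_hat_X = X.F_hat_iff[OF X.compatible_UNIV_open[OF TX]]
  note F_hat_Y = Y.F_hat_iff[OF Y.compatible_UNIV_open[OF TY]]
  fix B
  assume "B \<in> Lh ` F_hat \<nu>h \<iota> sX TX"
  then obtain A where A: "A \<in> F_hat \<nu>h \<iota> sX TX" "B = Lh A"
    by blast
  then have AE: "A \<in> ext_carrier \<iota> sX"
    using F_hat_X by blast
  have "\<exists>v\<in>V. Y.ext.cdist (Lh A) (Y.emb v) < \<epsilon>" if V: "openin TY V" "0 \<in> V" and "\<epsilon> > 0" for V \<epsilon>
  proof -
    obtain U where U: "openin TX U" "0 \<in> U" "L ` U \<subseteq> V"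
      using continuous_map_additive_iff[OF X.base.valuation_field_axioms TX TY L.add] cont V by blast
    obtain \<delta> where \<delta>: "\<delta> > 0" "\<forall>A\<in>ext_carrier \<iota> sX. \<forall>A'\<in>ext_carrier \<iota> sX.
        X.ext.cdist A A' < \<delta> \<longrightarrow> Y.ext.cdist (Lh A) (Lh A') < \<epsilon>"
      by (rule Lh_continuous[OF \<open>\<epsilon> > 0\<close>])
    obtain u where "u \<in> U" "X.ext.cdist A (X.emb u) < \<delta>"
      using A(1) U(1,2) \<delta>(1) F_hat_X by blast
    then have "L u \<in> V" "Y.ext.cdist (Lh A) (Y.emb (L u)) < \<epsilon>"
      using U(3) \<delta>(2) AE X.ext_tensor_in_carrier by (auto simp flip: Lh_emb)
    then show ?thesis
      by blast
  qed
  then show "B \<in> F_hat \<nu>h \<iota> sY TY"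
    unfolding F_hat_Y A(2) using Lh_carrier[OF AE] by blast
qed

text \<open>By \<open>emb_near_F_hat\<close> the points u of a suitable U are close to
  \<open>F_hat\<close> of \<open>TX\<close>, so \<open>emb (L u)\<close> is close to
  \<open>F_hat\<close> of \<open>TY\<close>, and \<open>nhd_contains_near_F_hat\<close> puts L u
  into V.\<close>

lemma Lh_F_hat_imp_continuous:
  assumes lc: "locally_compact_space (val_topology \<nu>h)"
    and nontrivial: "nontrivial_valuation \<nu>"
    and TX: "TX \<in> compatible_topologies (val_topology \<nu>) UNIV (+) sX"
    and TY: "TY \<in> compatible_topologies (val_topology \<nu>) UNIV (+) sY"
    and sub: "Lh ` F_hat \<nu>h \<iota> sX TX \<subseteq> F_hat \<nu>h \<iota> sY TY"
  shows "continuous_map TX TY L"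
proof -
  obtain t where t: "0 < \<nu> t" "\<nu> t < 1"
    by (rule X.base.nontrivial_obtains_small[OF nontrivial])
  have "\<exists>U. openin TX U \<and> 0 \<in> U \<and> L ` U \<subseteq> V" if V: "openin TY V" "0 \<in> V" for V
  proof -
    obtain \<epsilon> where \<epsilon>: "\<epsilon> > 0" "\<forall>z. \<forall>A\<in>F_hat \<nu>h \<iota> sY TY. Y.ext.cdist (Y.emb z) A < \<epsilon> \<longrightarrow> z \<in> V"
      by (rule Y.nhd_contains_near_F_hat[OF TY V])
    obtain \<delta> where \<delta>: "\<delta> > 0" "\<forall>A\<in>ext_carrier \<iota> sX. \<forall>A'\<in>ext_carrier \<iota> sX.
        X.ext.cdist A A' < \<delta> \<longrightarrow> Y.ext.cdist (Lh A) (Lh A') < \<epsilon>"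
      by (rule Lh_continuous[OF \<epsilon>(1)])
    obtain U where U: "openin TX U" "0 \<in> U"
        "\<forall>u\<in>U. \<exists>A\<in>F_hat \<nu>h \<iota> sX TX. X.ext.cdist (X.emb u) A < \<delta>"
      using X.emb_near_F_hat[OF TX lc t \<delta>(1)] by blast
    have "L u \<in> V" if u: "u \<in> U" for u
    proof -
      obtain A where A: "A \<in> F_hat \<nu>h \<iota> sX TX" "X.ext.cdist (X.emb u) A < \<delta>"
        using U(3) u by blast
      have "A \<in> ext_carrier \<iota> sX"
        using A(1) unfolding X.F_hat_iff[OF X.compatible_UNIV_open[OF TX]] by (rule conjunct1)
      then have "Y.ext.cdist (Lh (X.emb u)) (Lh A) < \<epsilon>"
        using A(2) \<delta>(2) X.ext_tensor_in_carrier by metis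
      then have "Y.ext.cdist (Y.emb (L u)) (Lh A) < \<epsilon>"
        by (simp only: Lh_emb)
      moreover have "Lh A \<in> F_hat \<nu>h \<iota> sY TY"
        using sub A(1) by blast
      ultimately show ?thesis
        using \<epsilon>(2) by blast
    qed
    with U(1,2) show ?thesis
      by blast
  qed
  then show ?thesis
    using continuous_map_additive_iff[OF X.base.valuation_field_axioms TX TY L.add] by blast
qed

end

theorem proposition5p1:
  fixes \<nu> :: "'k::field \<Rightarrow> real"
    and \<nu>h :: "'h::field \<Rightarrow> real"
    and \<iota> :: "'k \<Rightarrow> 'h"
    and sX :: "'k \<Rightarrow> 'x::ab_group_add \<Rightarrow> 'x"
    and sY :: "'k \<Rightarrow> 'y::ab_group_add \<Rightarrow> 'y"
    and L :: "'x \<Rightarrow> 'y"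
    and Lh :: "('h, 'x) ext \<Rightarrow> ('h, 'y) ext"
    and TX :: "'x topology" and TY :: "'y topology"
  assumes "valuation_field \<nu>"
    and "nontrivial_valuation \<nu>"
    and "valuation_completion \<nu> \<nu>h \<iota>"
    and "locally_compact_space (val_topology \<nu>h)"
    and "\<exists>B. finite_dimensional_vector_space sX B"
    and "\<exists>B. finite_dimensional_vector_space sY B"
    and "Vector_Spaces.linear sX sY L"
    and "TX \<in> compatible_topologies (val_topology \<nu>) UNIV (+) sX"
    and "TY \<in> compatible_topologies (val_topology \<nu>) UNIV (+) sY"
    and "ext_linear \<iota> sX sY Lh"
    and "\<And>\<alpha> x. Lh (ext_tensor \<iota> sX \<alpha> x) = ext_tensor \<iota> sY \<alpha> (L x)"
  shows "continuous_map TX TY L \<longleftrightarrow> Lh ` F_hat \<nu>h \<iota> sX TX \<subseteq> F_hat \<nu>h \<iota> sY TY"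
proof -
  \<comment> \<open>The bases serve to introduce coordinates; neither side of the equivalence
    mentions them.\<close>
  obtain BX BY where "finite_dimensional_vector_space sX BX" "finite_dimensional_vector_space sY BY"
    using assms by blast
  then interpret scalar_extension_linear \<nu> \<nu>h \<iota> sX BX sY BY L Lh
    using assms
    by (intro scalar_extension_linear.intro scalar_extension.intro scalar_extension_linear_axioms.intro)
  show ?thesis
    using continuous_imp_Lh_F_hat[OF assms(8,9)] Lh_F_hat_imp_continuous[OF assms(4,2,8,9)]
    by (rule iffI)
qed

end
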